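(* Given a string $S$ of length $n$ over an alphabet $\Sigma$ in which each letter appears at most three times, the problem LSRS+(3) can be solved in $O(n^4)$ time; that is, in $O(n^4)$ time one can either compute a maximum-length subsequence-repeated subsequence of $S$ in which every letter of $\Sigma$ appears, or determine that no such subsequence exists.
   Context: A subsequence of $S$ is a string obtained by deleting some letters of $S$. A subsequence $S'$ of $S$ is a subsequence-repeated subsequence (SRS) of $S$ if it has the form $x_1^{d_1}x_2^{d_2}\cdots x_k^{d_k}$, where each $x_i$ is a (nonempty) subsequence of $S$, $x_j\neq x_{j+1}$ for all $j\in[k-1]$, and $d_i\ge 2$ for all $i\in[k]$; here $x^d$ denotes $d$ consecutive copies of the string $x$. LSRS+($d$) is the problem: given $S$ over $\Sigma$ in which each letter occurs at most $d$ times, find an SRS of $S$ of maximum length such that all letters of $\Sigma$ appear in it. *)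

theory Defs
  imports Complex_Main "HOL-Library.Sublist" "HOL-Library.Landau_Symbols"
begin

definition is_srs :: "'a list \<Rightarrow> 'a list \<Rightarrow> bool" where
  "is_srs S S' \<longleftrightarrow> subseq S' S \<and>
     (\<exists>blocks :: ('a list \<times> nat) list. blocks \<noteq> [] \<and>
        S' = concat (map (\<lambda>(x, d). concat (replicate d x)) blocks) \<and>
        (\<forall>(x, d) \<in> set blocks. x \<noteq> [] \<and> subseq x S \<and> d \<ge> 2) \<and>
        (\<forall>j. Suc j < length blocks \<longrightarrow> fst (blocks ! j) \<noteq> fst (blocks ! Suc j)))"

definition lsrs_plus_instance :: "nat \<Rightarrow> 'a set \<Rightarrow> 'a list \<Rightarrow> bool" where
  "lsrs_plus_instance d \<Sigma> S \<longleftrightarrow>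
     finite \<Sigma> \<and> set S \<subseteq> \<Sigma> \<and> (\<forall>a \<in> \<Sigma>. count_list S a \<le> d)"

definition lsrs_plus_feasible :: "'a set \<Rightarrow> 'a list \<Rightarrow> 'a list \<Rightarrow> bool" where
  "lsrs_plus_feasible \<Sigma> S S' \<longleftrightarrow> is_srs S S' \<and> \<Sigma> \<subseteq> set S'"

definition lsrs_plus_answer :: "'a set \<Rightarrow> 'a list \<Rightarrow> 'a list option \<Rightarrow> bool" where
  "lsrs_plus_answer \<Sigma> S out \<longleftrightarrow>
     (case out of
        None \<Rightarrow> \<not> (\<exists>S'. lsrs_plus_feasible \<Sigma> S S')
      | Some S' \<Rightarrow> lsrs_plus_feasible \<Sigma> S S' \<and>
          (\<forall>S''. lsrs_plus_feasible \<Sigma> S S'' \<longrightarrow> length S'' \<le> length S'))"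

text \<open>Time is measured on a random access machine with unit-cost operations on machine words,
  programmed in a structured language.  A program uses finitely many registers and finitely many
  arrays, both named by natural numbers.  Every intermediate value, including array indices,
  must be smaller than the word bound \<open>W\<close>; there is no execution for a program that overflows.\<close>

record state =
  reg :: "nat \<Rightarrow> nat"
  arr :: "nat \<Rightarrow> nat \<Rightarrow> nat"

datatype aexp = Const nat | Reg nat | Load nat aexp
  | Plus aexp aexp | Minus aexp aexp | Times aexp aexp

datatype bexp = Less aexp aexp | Equal aexp aexp | Not bexp | And bexp bexp

datatype com = Skip
  | Assign nat aexp
  | Store nat aexp aexp
  | Seq com com
  | If bexp com com
  | While bexp com

fun aval :: "aexp \<Rightarrow> state \<Rightarrow> nat" where
  "aval (Const k) s = k"
| "aval (Reg x) s = reg s x"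
| "aval (Load A i) s = arr s A (aval i s)"
| "aval (Plus a b) s = aval a s + aval b s"
| "aval (Minus a b) s = aval a s - aval b s"
| "aval (Times a b) s = aval a s * aval b s"

fun afits :: "nat \<Rightarrow> aexp \<Rightarrow> state \<Rightarrow> bool" where
  "afits W (Const k) s \<longleftrightarrow> k < W"
| "afits W (Reg x) s \<longleftrightarrow> reg s x < W"
| "afits W (Load A i) s \<longleftrightarrow> afits W i s \<and> arr s A (aval i s) < W"
| "afits W (Plus a b) s \<longleftrightarrow> afits W a s \<and> afits W b s \<and> aval a s + aval b s < W"
| "afits W (Minus a b) s \<longleftrightarrow> afits W a s \<and> afits W b s"
| "afits W (Times a b) s \<longleftrightarrow> afits W a s \<and> afits W b s \<and> aval a s * aval b s < W"

fun acost :: "aexp \<Rightarrow> nat" where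
  "acost (Const k) = 1"
| "acost (Reg x) = 1"
| "acost (Load A i) = 1 + acost i"
| "acost (Plus a b) = 1 + acost a + acost b"
| "acost (Minus a b) = 1 + acost a + acost b"
| "acost (Times a b) = 1 + acost a + acost b"

fun bval :: "bexp \<Rightarrow> state \<Rightarrow> bool" where
  "bval (Less a b) s \<longleftrightarrow> aval a s < aval b s"
| "bval (Equal a b) s \<longleftrightarrow> aval a s = aval b s"
| "bval (Not b) s \<longleftrightarrow> \<not> bval b s"
| "bval (And b c) s \<longleftrightarrow> bval b s \<and> bval c s"

fun bfits :: "nat \<Rightarrow> bexp \<Rightarrow> state \<Rightarrow> bool" where
  "bfits W (Less a b) s \<longleftrightarrow> afits W a s \<and> afits W b s"
| "bfits W (Equal a b) s \<longleftrightarrow> afits W a s \<and> afits W b s"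
| "bfits W (Not b) s \<longleftrightarrow> bfits W b s"
| "bfits W (And b c) s \<longleftrightarrow> bfits W b s \<and> bfits W c s"

fun bcost :: "bexp \<Rightarrow> nat" where
  "bcost (Less a b) = 1 + acost a + acost b"
| "bcost (Equal a b) = 1 + acost a + acost b"
| "bcost (Not b) = 1 + bcost b"
| "bcost (And b c) = 1 + bcost b + bcost c"

text \<open>\<open>exec W c s t s'\<close>: with word bound \<open>W\<close>, command \<open>c\<close> started in \<open>s\<close> halts in \<open>s'\<close>
  after \<open>t\<close> elementary operations.\<close>

inductive exec :: "nat \<Rightarrow> com \<Rightarrow> state \<Rightarrow> nat \<Rightarrow> state \<Rightarrow> bool" for W :: nat where
  Skip: "exec W Skip s 1 s"
| Assign: "afits W a s \<Longrightarrow>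
    exec W (Assign x a) s (1 + acost a) (s\<lparr>reg := (reg s)(x := aval a s)\<rparr>)"
| Store: "afits W i s \<Longrightarrow> afits W a s \<Longrightarrow>
    exec W (Store A i a) s (1 + acost i + acost a)
      (s\<lparr>arr := (arr s)(A := (arr s A)(aval i s := aval a s))\<rparr>)"
| Seq: "exec W c\<^sub>1 s t\<^sub>1 s' \<Longrightarrow> exec W c\<^sub>2 s' t\<^sub>2 s'' \<Longrightarrow> exec W (Seq c\<^sub>1 c\<^sub>2) s (t\<^sub>1 + t\<^sub>2) s''"
| IfTrue: "bfits W b s \<Longrightarrow> bval b s \<Longrightarrow> exec W c\<^sub>1 s t s' \<Longrightarrow>
    exec W (If b c\<^sub>1 c\<^sub>2) s (1 + bcost b + t) s'"
| IfFalse: "bfits W b s \<Longrightarrow> \<not> bval b s \<Longrightarrow> exec W c\<^sub>2 s t s' \<Longrightarrow>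
    exec W (If b c\<^sub>1 c\<^sub>2) s (1 + bcost b + t) s'"
| WhileFalse: "bfits W b s \<Longrightarrow> \<not> bval b s \<Longrightarrow> exec W (While b c) s (1 + bcost b) s"
| WhileTrue: "bfits W b s \<Longrightarrow> bval b s \<Longrightarrow> exec W c s t\<^sub>1 s' \<Longrightarrow>
    exec W (While b c) s' t\<^sub>2 s'' \<Longrightarrow> exec W (While b c) s (1 + bcost b + t\<^sub>1 + t\<^sub>2) s''"

inductive_cases exec_SkipE: "exec W Skip s t s'"
inductive_cases exec_AssignE: "exec W (Assign x a) s t s'"
inductive_cases exec_StoreE: "exec W (Store A i a) s t s'"
inductive_cases exec_SeqE: "exec W (Seq c\<^sub>1 c\<^sub>2) s t s'"
inductive_cases exec_IfE: "exec W (If b c\<^sub>1 c\<^sub>2) s t s'"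
inductive_cases exec_WhileE: "exec W (While b c) s t s'"

lemma exec_deterministic:
  "exec W c s t s' \<Longrightarrow> exec W c s u s'' \<Longrightarrow> t = u \<and> s' = s''"
proof (induction arbitrary: u s'' rule: exec.induct)
  case (Skip s)
  then show ?case by (rule exec_SkipE) simp
next
  case (Assign a s x)
  from Assign.prems show ?case by (rule exec_AssignE) simp
next
  case (Store i s a A)
  from Store.prems show ?case by (rule exec_StoreE) simp
next
  case (Seq c1 s t1 s1 c2 t2 s2)
  from Seq.prems show ?case
  proof (rule exec_SeqE)
    fix v1 r v2 assume u: "u = v1 + v2" and r: "exec W c1 s v1 r" "exec W c2 r v2 s''"
    from Seq.IH(1)[OF r(1)] r(2) have v1: "t1 = v1" and "exec W c2 s1 v2 s''" by simp_all
    from Seq.IH(2)[OF this(2)] v1 u show ?thesis by simp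
  qed
next
  case (IfTrue b s c1 t s1 c2)
  from IfTrue.prems IfTrue.hyps(2) obtain v where u: "u = 1 + bcost b + v" and r: "exec W c1 s v s''"
    by (auto elim: exec_IfE)
  from IfTrue.IH[OF r] u show ?case by simp
next
  case (IfFalse b s c2 t s1 c1)
  from IfFalse.prems IfFalse.hyps(2) obtain v where u: "u = 1 + bcost b + v" and r: "exec W c2 s v s''"
    by (auto elim: exec_IfE)
  from IfFalse.IH[OF r] u show ?case by simp
next
  case (WhileFalse b s c)
  from WhileFalse.prems WhileFalse.hyps(2) show ?case by (auto elim: exec_WhileE)
next
  case (WhileTrue b s c t1 s1 t2 s2)
  from WhileTrue.prems WhileTrue.hyps(2) obtain v1 r v2
    where u: "u = 1 + bcost b + v1 + v2"
      and r: "exec W c s v1 r" "exec W (While b c) r v2 s''"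
    by (auto elim: exec_WhileE)
  from WhileTrue.IH(1)[OF r(1)] r(2) have v1: "t1 = v1" and "exec W (While b c) s1 v2 s''"
    by simp_all
  from WhileTrue.IH(2)[OF this(2)] v1 u show ?case by simp
qed

text \<open>The alphabet is \<open>{..<m}\<close>.  Register 0 initially holds the length of the string, register 1
  the alphabet size \<open>m\<close>, and array 0 the string; everything else is 0.  On halting, register 0
  is 0 if the answer is that no solution exists; otherwise array 1 holds the computed string,
  whose length is in register 1.\<close>

definition input_state :: "nat \<Rightarrow> nat list \<Rightarrow> state" where
  "input_state m S =
     \<lparr>reg = (\<lambda>_. 0)(0 := length S, 1 := m),
      arr = (\<lambda>_ _. 0)(0 := (\<lambda>i. if i < length S then S ! i else 0))\<rparr>"

definition output_of :: "state \<Rightarrow> nat list option" where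
  "output_of s = (if reg s 0 = 0 then None else Some (map (arr s 1) [0..<reg s 1]))"

end

theory Submission
  imports Defs
begin

text \<open>A letter occurs at most three times in \<open>S\<close>, so it belongs to exactly one block \<open>x\<^sup>d\<close>, with
  \<open>d \<in> {2, 3}\<close>, and it occurs once in \<open>x\<close>.  Hence the letters used up to a boundary between blocks are
  those whose second occurrence in \<open>S\<close> lies before it, and a dynamic program over these boundaries
  suffices.  It remains to find, for all starts \<open>p\<close> and ends \<open>q\<close>, a block with exponent \<open>d\<close> that uses
  exactly the letters whose second occurrence lies between \<open>p\<close> and \<open>q\<close>.  For \<open>d = 3\<close> all occurrences
  are used.  For \<open>d = 2\<close> fix the position \<open>r\<close> where the two copies meet; then each letter is used at one
  of two pairs of positions around \<open>r\<close>, a short one and one containing it, and the pairs must not be nested.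
  A nested short pair has to be widened, so there is a least solution, and the widenings forced for
  \<open>q\<close> stay forced for larger \<open>q\<close>.  For fixed \<open>p\<close> and \<open>r\<close> this takes a linear number of rounds of linear
  time, which gives \<open>O(n\<^sup>4)\<close>.\<close>

section \<open>Blocks and boundaries\<close>

text \<open>One array of skipped positions serves all ends \<open>q\<close> belonging to a start and
  a split point; resetting it for every \<open>q\<close> would cost another factor n. So the search
  may abandon all later ends at once, and the task is to show that it never does so before an end it
  must reach. Three choices make this work. The word tested for \<open>q\<close> contains the
  occurrences of its letters up to the end of the string, not only up to \<open>q\<close>, so a
  widening forced for \<open>q\<close> does not depend on where the block will end; only recording a
  block asks that its last position is at most \<open>q\<close>. A mismatch between the two copies
  points to the letter read in the second copy, whose pair is the nested one, and only that letter
  is widened. Soundness is kept apart from all this: whatever the skips are, a block is recorded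
  only after its length, its period and its last position have been tested. A round advances
  \<open>q\<close>, widens one more letter or gives up, so there are at most 2(n+1) rounds, and a
  linear round can also afford to copy a whole string into the table. Cubes are sought with split
  point 0, starting with nothing skipped.\<close>

lemma subseq_mapD:
  assumes "subseq xs (map h ys)"
  obtains zs where "subseq zs ys" "map h zs = xs"
  using assms unfolding subseq_conv_nths by (metis nths_map)

lemma upt_split: "p \<le> r \<Longrightarrow> r \<le> e \<Longrightarrow> [Suc p..<Suc e] = [Suc p..<Suc r] @ [Suc r..<Suc e]"
  by (metis Suc_le_mono le_add_diff_inverse upt_add_eq_append)

lemma strict_sorted_upt [simp]: "sorted_wrt (<) [a..<b::nat]"
  by (simp add: strict_sorted_iff)

lemma strict_sorted_subseq:
  assumes "subseq xs ys" "sorted_wrt (<) (ys :: nat list)" shows "sorted_wrt (<) xs"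
  using assms unfolding strict_sorted_iff
  by (metis sorted_nths distinct_nthsI subseq_conv_nths)

lemma count_list_concat_replicate:
  "count_list (concat (replicate d x)) a = d * count_list x a"
  by (induction d) auto

lemma count_list_concat_map:
  "b \<in> set bs \<Longrightarrow> count_list (f b) a \<le> count_list (concat (map f bs)) a"
  by (induction bs) auto

lemma subseq_count_le: "subseq xs ys \<Longrightarrow> count_list xs a \<le> count_list ys a"
  by (induction rule: list_emb.induct) auto

lemma distinct_count_le: "(\<And>a. count_list xs a \<le> 1) \<Longrightarrow> distinct xs"
proof (induction xs)
  case (Cons y ys)
  have "y \<notin> set ys" using Cons.prems[of y] by (auto simp: count_list_0_iff)
  moreover have "count_list ys a \<le> 1" for a using Cons.prems[of a] by (auto split: if_splits)
  ultimately show ?case using Cons.IH by simp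
qed simp

lemma count_list_distinct: "distinct xs \<Longrightarrow> count_list xs a = (if a \<in> set xs then 1 else 0)"
  by (induction xs) auto

lemma length_filter_eq_sum_count:
  assumes "finite A"
  shows "length (filter (\<lambda>a. a \<in> A) xs) = (\<Sum>a\<in>A. count_list xs a)"
proof (induction xs)
  case (Cons x xs)
  have "(\<Sum>a\<in>A. count_list (x # xs) a) = (\<Sum>a\<in>A. count_list xs a + (if x = a then 1 else 0))"
    by (intro sum.cong) auto
  then show ?case using Cons assms by (simp add: sum.distrib)
qed simp

text \<open>This is how the program recognises a power: it compares single entries at distance
  \<open>c\<close>, never whole copies.\<close>

lemma periodic_eq_concat_replicate:
  assumes "length y = d * c" "\<And>j. j + c < length y \<Longrightarrow> y ! j = y ! (j + c)"
  shows "y = concat (replicate d (take c y))"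
  using assms
proof (induction d arbitrary: y)
  case (Suc d)
  show ?case
  proof (cases d)
    case 0 then show ?thesis using Suc.prems by simp
  next
    case (Suc e)
    have len: "length (drop c y) = d * c" using Suc.prems(1) by simp
    have "drop c y = concat (replicate d (take c (drop c y)))"
    proof (rule Suc.IH[OF len])
      fix j assume j: "j + c < length (drop c y)"
      then show "drop c y ! j = drop c y ! (j + c)"
        using Suc.prems(2)[of "j + c"] by (simp add: add_ac)
    qed
    moreover have "take c (drop c y) = take c y"
    proof (rule nth_equalityI)
      show "length (take c (drop c y)) = length (take c y)"
        using Suc.prems(1) Suc by simp
      fix i assume "i < length (take c (drop c y))"
      then show "take c (drop c y) ! i = take c y ! i"
        using Suc.prems(1) Suc.prems(2)[of i] by (simp add: add.commute)
    qed
    ultimately show ?thesis by (metis append_take_drop_id concat.simps(2) replicate_Suc)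
  qed
qed simp

section \<open>Occurrences of letters, and the letters that become new between two
  boundaries\<close>

locale thrice =
  fixes S :: "nat list"
  assumes three: "count_list S a \<le> 3"
begin

text \<open>Positions are counted from 1, so that 0 can stand for a missing occurrence.\<close>

definition letter :: "nat \<Rightarrow> nat" where "letter i = S ! (i - 1)"

definition positions_upto :: "nat \<Rightarrow> nat \<Rightarrow> nat list" where
  "positions_upto i a = filter (\<lambda>j. letter j = a) [1..<Suc i]"

text \<open>\<open>k\<close> counts from 0. The bound \<open>i\<close> is a parameter so that
  \<open>occ k i\<close> also describes the occurrence tables after only \<open>i\<close> letters
  have been read.\<close>

definition occ :: "nat \<Rightarrow> nat \<Rightarrow> nat \<Rightarrow> nat" where
  "occ k i a = (if k < length (positions_upto i a) then positions_upto i a ! k else 0)"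

abbreviation "o1 \<equiv> occ 0 (length S)"
abbreviation "o2 \<equiv> occ 1 (length S)"
abbreviation "o3 \<equiv> occ 2 (length S)"

text \<open>The default \<open>o2 a = 0\<close> keeps out letters with fewer than two occurrences,
  whatever \<open>p\<close> is.\<close>

definition new_letters :: "nat \<Rightarrow> nat \<Rightarrow> nat set" where
  "new_letters p q = {a. p < o2 a \<and> o2 a \<le> q}"

definition window :: "nat \<Rightarrow> nat \<Rightarrow> nat list" where
  "window p q = map letter [Suc p..<Suc q]"

lemma window_append: "p \<le> q \<Longrightarrow> q \<le> r \<Longrightarrow> window p q @ window q r = window p r"
  unfolding window_def by (metis map_append upt_split)

lemma window_0: "q \<le> length S \<Longrightarrow> window 0 q = take q S"
  by (rule nth_equalityI) (auto simp: window_def letter_def simp del: upt_Suc)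

lemma window_full: "window 0 (length S) = S"
  by (simp add: window_0)

lemma length_window: "length (window p q) = q - p"
  by (simp add: window_def del: upt_Suc)

lemma positions_upto_Suc: "positions_upto (Suc i) a = positions_upto i a @ (if letter (Suc i) = a then [Suc i] else [])"
  by (simp add: positions_upto_def)

lemma positions_upto_0 [simp]: "positions_upto 0 a = []"
  by (simp add: positions_upto_def)

lemma count_take: "i \<le> length S \<Longrightarrow> count_list (take i S) a = length (positions_upto i a)"
  by (induction i) (auto simp: positions_upto_Suc take_Suc_conv_app_nth letter_def)

lemma length_posl_le: "i \<le> length S \<Longrightarrow> length (positions_upto i a) \<le> 3"
  using count_take[of i a] three[of a] subseq_count_le[of "take i S" S a]
  by (metis order_trans prefix_imp_subseq take_is_prefix)

lemma positions_upto_split: "q \<le> r \<Longrightarrow> positions_upto r a = positions_upto q a @ filter (\<lambda>j. letter j = a) [Suc q..<Suc r]"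
proof -
  assume "q \<le> r"
  then have "[1..<Suc r] = [1..<Suc q] @ [Suc q..<Suc r]"
    by (metis Suc_le_mono le_add_diff_inverse One_nat_def le_add1 plus_1_eq_Suc upt_add_eq_append)
  then show ?thesis unfolding positions_upto_def by (metis filter_append)
qed

lemma set_positions_upto: "set (positions_upto i a) = {j. 1 \<le> j \<and> j \<le> i \<and> letter j = a}"
  by (auto simp: positions_upto_def)

text \<open>The positions up to \<open>q\<close> form an initial part of the list of all positions,
  so the entry with index 1 lies in that part exactly if the part has at least two elements. This
  turns boundary conditions into counts, with which the bound 3 can be used.\<close>

lemma o2_le_iff:
  assumes "q \<le> length S"
  shows "0 < o2 a \<and> o2 a \<le> q \<longleftrightarrow> 2 \<le> count_list (take q S) a"
proof -
  let ?R = "filter (\<lambda>j. letter j = a) [Suc q..<Suc (length S)]"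
  note sp = positions_upto_split[OF assms, of a]
  show ?thesis
  proof (cases "2 \<le> length (positions_upto q a)")
    case True
    then have "o2 a = positions_upto q a ! 1" by (auto simp: occ_def sp nth_append simp del: upt_Suc)
    moreover have "positions_upto q a ! 1 \<in> set (positions_upto q a)" using True by (intro nth_mem) simp
    ultimately show ?thesis using True by (auto simp: set_positions_upto count_take assms)
  next
    case False
    show ?thesis
    proof (cases "1 < length (positions_upto (length S) a)")
      case len: True
      then have "o2 a = ?R ! (1 - length (positions_upto q a))"
        using False by (simp add: occ_def sp nth_append del: upt_Suc)
      moreover have "1 - length (positions_upto q a) < length ?R"
        using False len sp by (simp del: upt_Suc)
      then have "?R ! (1 - length (positions_upto q a)) \<in> set ?R" by (rule nth_mem)
      moreover have "q < z" if "z \<in> set ?R" for z using that by (auto simp del: upt_Suc)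
      ultimately have "q < o2 a" by metis
      then show ?thesis using False by (simp add: count_take assms)
    next
      case False': False
      then show ?thesis using False by (simp add: occ_def count_take assms)
    qed
  qed
qed

lemma new_letters_iff:
  assumes "p \<le> q" "q \<le> length S"
  shows "a \<in> new_letters p q \<longleftrightarrow> count_list (take p S) a < 2 \<and> 2 \<le> count_list (take q S) a"
  using o2_le_iff[of p a] o2_le_iff[of q a] assms unfolding new_letters_def by auto

lemma new_letters_union: "p \<le> q \<Longrightarrow> q \<le> r \<Longrightarrow> new_letters p q \<union> new_letters q r = new_letters p r"
  by (auto simp: new_letters_def)

lemma occurrences:
  assumes "0 < o2 a"
  shows "0 < o1 a" "o1 a < o2 a" "o2 a \<le> length S" "letter (o1 a) = a" "letter (o2 a) = a"
    "0 < o3 a \<Longrightarrow> o2 a < o3 a \<and> o3 a \<le> length S \<and> letter (o3 a) = a"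
proof -
  let ?p = "positions_upto (length S) a"
  have len: "1 < length ?p" using assms by (auto simp: occ_def split: if_splits)
  have sorted: "sorted_wrt (<) ?p"
    unfolding positions_upto_def by (rule strict_sorted_subseq[OF subseq_filter_left strict_sorted_upt])
  have mem: "k < length ?p \<Longrightarrow> 1 \<le> ?p ! k \<and> ?p ! k \<le> length S \<and> letter (?p ! k) = a" for k
    using nth_mem[of k ?p] by (simp add: set_positions_upto)
  have e: "o1 a = ?p ! 0" "o2 a = ?p ! 1" using len by (auto simp: occ_def)
  show "0 < o1 a" "o2 a \<le> length S" "letter (o1 a) = a" "letter (o2 a) = a"
    using mem[of 1, OF len] mem[of 0] order.strict_trans[OF zero_less_one len] unfolding e by auto
  show "o1 a < o2 a" using sorted len unfolding e by (simp add: sorted_wrt_iff_nth_less)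
  show "o2 a < o3 a \<and> o3 a \<le> length S \<and> letter (o3 a) = a" if "0 < o3 a"
  proof -
    have "2 < length ?p" "o3 a = ?p ! 2" using that by (auto simp: occ_def split: if_splits)
    then show ?thesis using mem[of 2] sorted len unfolding e by (simp add: sorted_wrt_iff_nth_less)
  qed
qed

lemma occurrence_cases:
  assumes "1 \<le> i" "i \<le> length S"
  shows "i = o1 (letter i) \<or> i = o2 (letter i) \<or> i = o3 (letter i)"
proof -
  let ?p = "positions_upto (length S) (letter i)"
  have "i \<in> set ?p" using assms by (simp add: set_positions_upto)
  then obtain k where k: "k < length ?p" "?p ! k = i" by (auto simp: in_set_conv_nth)
  then have "k < 3" using length_posl_le[of "length S" "letter i"] by simp
  then have "k = 0 \<or> k = 1 \<or> k = 2" by auto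
  with k show ?thesis by (auto simp: occ_def)
qed

lemma new_letters_occ:
  assumes "a \<in> new_letters p q"
  shows "0 < o1 a" "o1 a < o2 a" "o2 a \<le> length S" "letter (o1 a) = a" "letter (o2 a) = a"
    "0 < o3 a \<Longrightarrow> o2 a < o3 a \<and> o3 a \<le> length S \<and> letter (o3 a) = a" "p < o2 a" "o2 a \<le> q"
  using assms occurrences[of a] by (auto simp: new_letters_def)

lemma new_letters_subset_set: "new_letters p q \<subseteq> set S"
proof
  fix a assume "a \<in> new_letters p q"
  from new_letters_occ[OF this] have "letter (o2 a) = a" "0 < o2 a" "o2 a \<le> length S" by auto
  then show "a \<in> set S" unfolding letter_def
    by (metis One_nat_def Suc_le_eq Suc_pred nth_mem)
qed

lemma finite_new_letters [simp]: "finite (new_letters p q)"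
  using new_letters_subset_set finite_subset by blast

section \<open>Solutions up to a boundary, and their equivalence with feasible strings\<close>

definition is_block :: "nat \<Rightarrow> nat \<Rightarrow> nat \<Rightarrow> nat list \<Rightarrow> bool" where
  "is_block p q d x \<longleftrightarrow> set x = new_letters p q \<and> distinct x \<and> subseq (concat (replicate d x)) (window p q)"

lemma is_block_length: "is_block p q d x \<Longrightarrow> length (concat (replicate d x)) = d * card (new_letters p q)"
  by (auto simp: is_block_def length_concat sum_list_replicate distinct_card[symmetric])

text \<open>\<open>x\<close> is empty when no letter has its second occurrence between
  \<open>p\<close> and \<open>q\<close>; such a step only moves the boundary, for instance from the
  last block to the end of the string. Neighbouring nonempty blocks differ because their letters are
  disjoint.\<close>

inductive prefix_solution :: "nat \<Rightarrow> nat list \<Rightarrow> bool" where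
  prefix_solution_0: "prefix_solution 0 []"
| prefix_solution_step: "prefix_solution p w \<Longrightarrow> p < q \<Longrightarrow> q \<le> length S \<Longrightarrow> d \<in> {2, 3} \<Longrightarrow> is_block p q d x
    \<Longrightarrow> prefix_solution q (w @ concat (replicate d x))"

lemma prefix_solution_le: "prefix_solution q w \<Longrightarrow> q \<le> length S"
  by (induction rule: prefix_solution.induct) auto

lemma prefix_solution_subseq: "prefix_solution q w \<Longrightarrow> subseq w (take q S)"
proof (induction rule: prefix_solution.induct)
  case (prefix_solution_step p w q d x)
  have "take q S = take p S @ window p q"
    using window_append[of 0 p q] window_0[of p] window_0[of q] prefix_solution_step by simp
  then show ?case using prefix_solution_step by (auto simp: is_block_def intro: list_emb_append_mono)
qed simp

lemma prefix_solution_length: "prefix_solution q w \<Longrightarrow> length w \<le> length S"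
  using prefix_solution_subseq[of q w] list_emb_length[of "(=)" w "take q S"] by simp

lemma prefix_solution_set: "prefix_solution q w \<Longrightarrow> set w = new_letters 0 q"
proof (induction rule: prefix_solution.induct)
  case (prefix_solution_step p w q d x)
  then have "set (concat (replicate d x)) = new_letters p q"
    by (auto simp: is_block_def)
  with prefix_solution_step new_letters_union[of 0 p q] show ?case by auto
qed (auto simp: new_letters_def)

text \<open>Empty steps are dropped here, since an SRS has nonempty blocks only. Distinctness of the
  letters over all blocks is the form of \<open>x_j\<close> differing from its successor that
  survives the induction.\<close>

lemma prefix_solution_blocks:
  "prefix_solution q w \<Longrightarrow> \<exists>bs. w = concat (map (\<lambda>(x, d). concat (replicate d x)) bs) \<and>
     (\<forall>(x, d) \<in> set bs. x \<noteq> [] \<and> d \<ge> 2) \<and> distinct (concat (map fst bs)) \<and>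
     set (concat (map fst bs)) = new_letters 0 q"
proof (induction rule: prefix_solution.induct)
  case prefix_solution_0
  show ?case by (rule exI[of _ "[]"]) (auto simp: new_letters_def)
next
  case (prefix_solution_step p w q d x)
  then obtain bs where bs: "w = concat (map (\<lambda>(x, d). concat (replicate d x)) bs)"
     "\<forall>(x, d) \<in> set bs. x \<noteq> [] \<and> d \<ge> 2" "distinct (concat (map fst bs))"
     "set (concat (map fst bs)) = new_letters 0 p" by auto
  have U: "new_letters 0 p \<union> new_letters p q = new_letters 0 q" using prefix_solution_step by (simp add: new_letters_union)
  have disj: "new_letters 0 p \<inter> new_letters p q = {}" by (auto simp: new_letters_def)
  show ?case
  proof (cases "x = []")
    case True
    then show ?thesis using bs prefix_solution_step U by (intro exI[of _ bs]) (auto simp: is_block_def)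
  next
    case False
    show ?thesis
    proof (intro exI[of _ "bs @ [(x, d)]"] conjI)
      show "set (concat (map fst (bs @ [(x, d)]))) = new_letters 0 q"
        using bs(4) prefix_solution_step U by (auto simp: is_block_def)
      show "distinct (concat (map fst (bs @ [(x, d)])))"
        using bs(3,4) prefix_solution_step(6) disj prefix_solution_step(5) unfolding map_append concat_append distinct_append
        by (auto simp: is_block_def)
    qed (use bs prefix_solution_step False in auto)
  qed
qed

lemma prefix_solution_is_srs:
  assumes "prefix_solution (length S) w" "w \<noteq> []"
  shows "is_srs S w"
proof -
  obtain bs where bs: "w = concat (map (\<lambda>(x, d). concat (replicate d x)) bs)"
     "\<forall>(x, d) \<in> set bs. x \<noteq> [] \<and> d \<ge> 2" "distinct (concat (map fst bs))"
    using prefix_solution_blocks[OF assms(1)] by auto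
  have sub: "subseq w S" using prefix_solution_subseq[OF assms(1)] by simp
  have "subseq x S" if "(x, d) \<in> set bs" for x d
  proof -
    from that obtain u v where uv: "bs = u @ (x, d) # v" by (meson split_list)
    have "2 \<le> d" using bs(2) that by auto
    then obtain e where "d = Suc e" by (cases d) auto
    then have "\<exists>u' v'. w = u' @ x @ v'" unfolding bs(1) uv by auto
    then show ?thesis using sub
      by (metis subseq_append' subseq_drop_many subseq_order.trans subseq_rev_drop_many subseq_order.refl)
  qed
  moreover have "fst (bs ! j) \<noteq> fst (bs ! Suc j)" if j: "Suc j < length bs" for j
  proof
    assume eq: "fst (bs ! j) = fst (bs ! Suc j)"
    have "map fst bs = take j (map fst bs) @ fst (bs ! j) # fst (bs ! Suc j) # drop (Suc (Suc j)) (map fst bs)"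
      using j by (simp add: Cons_nth_drop_Suc drop_map take_map flip: list.map(2) map_append)
    then have "distinct (concat (take j (map fst bs) @ fst (bs ! j) # fst (bs ! Suc j) # drop (Suc (Suc j)) (map fst bs)))"
      using bs(3) by simp
    \<comment> \<open>Two equal neighbours in a distinct concatenation are disjoint from
      themselves.\<close>
    then have "fst (bs ! j) = []" using eq by auto
    moreover have "fst (bs ! j) \<noteq> []"
      using bs(2) nth_mem[of j bs] j by (auto simp: case_prod_beta)
    ultimately show False by simp
  qed
  moreover have "bs \<noteq> []" using assms(2) bs(1) by auto
  ultimately show ?thesis unfolding is_srs_def using sub bs(1,2)
    by (intro conjI exI[of _ bs]) auto
qed

text \<open>A block spends at least two of the at most three occurrences of each of its letters.
  Together with the last assumption, that no letter occurring twice is left out, this forces the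
  letters of every block to be exactly those new between its boundaries. The induction peels off the
  first block and moves the boundary \<open>p\<close>.\<close>

lemma blocks_prefix_solution:
  assumes "prefix_solution p w" "subseq (concat (map (\<lambda>(x, d). concat (replicate d x)) bs)) (window p (length S))"
    "\<forall>(x, d) \<in> set bs. x \<noteq> [] \<and> d \<ge> 2"
    "\<forall>a \<in> new_letters 0 (length S). a \<in> set w \<or> (\<exists>(x, d) \<in> set bs. a \<in> set x)"
  shows "prefix_solution (length S) (w @ concat (map (\<lambda>(x, d). concat (replicate d x)) bs))"
  using assms
proof (induction bs arbitrary: p w)
  case Nil
  have "p \<le> length S" using Nil prefix_solution_le by simp
  show ?case
  proof (cases "p = length S")
    case False
    have "set w = new_letters 0 p" using prefix_solution_set Nil by simp
    \<comment> \<open>All letters that occur twice are already in \<open>w\<close>, so an empty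
      square leads from \<open>p\<close> to the end of the string.\<close>
    then have "new_letters 0 (length S) \<subseteq> new_letters 0 p" using Nil(4) by auto
    moreover have "new_letters p (length S) \<subseteq> new_letters 0 (length S)" unfolding new_letters_def by force
    moreover have "new_letters p (length S) \<inter> new_letters 0 p = {}" unfolding new_letters_def by force
    ultimately have "new_letters p (length S) = {}" by blast
    then have "is_block p (length S) 2 []" by (auto simp: is_block_def)
    from prefix_solution_step[OF Nil(1) _ _ _ this] False \<open>p \<le> length S\<close> show ?thesis by auto
  qed (use Nil in auto)
next
  case (Cons b bs)
  obtain x d where b: "b = (x, d)" by (cases b)
  let ?R = "concat (map (\<lambda>(x, d). concat (replicate d x)) bs)"
  have p: "p \<le> length S" using Cons(2) prefix_solution_le by simp
  have xd: "x \<noteq> []" "d \<ge> 2" using Cons.prems b by auto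
  have "subseq (concat (replicate d x) @ ?R) (window p (length S))" using Cons.prems b by simp
  then obtain w1 w2 where w12: "window p (length S) = w1 @ w2" "subseq (concat (replicate d x)) w1" "subseq ?R w2"
    by (meson list_emb_appendD)
  \<comment> \<open>The boundary is put right behind the part of the window into which the first
    block is embedded.\<close>
  define q where "q = p + length w1"
  have q: "p \<le> q" "q \<le> length S"
    using arg_cong[OF w12(1), of length] p by (auto simp: q_def length_window)
  have "w1 @ w2 = window p q @ window q (length S)" using w12 q by (simp add: window_append)
  moreover have "length w1 = length (window p q)" by (simp add: length_window q_def)
  ultimately have w1: "w1 = window p q" and w2: "w2 = window q (length S)" by simp_all
  have S3: "count_list (take p S) a + count_list (window p q) a + count_list (window q (length S)) a \<le> 3" for a
    using three[of a] window_full window_append[of 0 p q] window_append[of 0 q "length S"] window_0[of p] p q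
    by (metis count_list_append le0)
  have tq: "count_list (take q S) a = count_list (take p S) a + count_list (window p q) a" for a
    using window_append[of 0 p q] window_0[of p] window_0[of q] p q by (metis count_list_append le0)
  have cw: "d * count_list x a \<le> count_list (window p q) a" for a
    using subseq_count_le[OF w12(2), of a] by (simp add: count_list_concat_replicate w1)
  \<comment> \<open>A letter repeated in \<open>x\<close> would need at least 2 * 2 occurrences in
    the string.\<close>
  have cx: "count_list x a \<le> 1" for a
  proof (rule ccontr)
    assume "\<not> ?thesis"
    then have "2 * 2 \<le> d * count_list x a" using xd(2) by (intro mult_le_mono) auto
    then show False using cw[of a] S3[of a] by linarith
  qed
  then have dist: "distinct x" by (rule distinct_count_le)
  have d: "d \<in> {2, 3}"
  proof -
    obtain a where "a \<in> set x" using xd by (meson hd_in_set)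
    then have "count_list x a = 1" using dist by (simp add: count_list_distinct)
    then have "d \<le> 3" using cw[of a] S3[of a] by simp
    then show ?thesis using xd(2) by auto
  qed
  have "set x = new_letters p q"
  proof (intro equalityI subsetI)
    fix a assume "a \<in> set x"
    then have "count_list x a = 1" using dist by (simp add: count_list_distinct)
    \<comment> \<open>At least two of the three occurrences lie between \<open>p\<close> and
      \<open>q\<close>, hence at most one lies before \<open>p\<close>.\<close>
    then show "a \<in> new_letters p q" using cw[of a] S3[of a] tq[of a] xd(2) q by (simp add: new_letters_iff)
  next
    fix a assume a: "a \<in> new_letters p q"
    show "a \<in> set x"
    proof (rule ccontr)
      \<comment> \<open>A letter left to a later block uses two occurrences behind \<open>q\<close>,
        in addition to the two up to \<open>q\<close>.\<close>
      assume nx: "a \<notin> set x"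
      have "a \<notin> set w" using prefix_solution_set[OF Cons.prems(1)] a by (auto simp: new_letters_def)
      moreover have "a \<in> new_letters 0 (length S)" using a q by (auto simp: new_letters_def)
      ultimately obtain x' d' where x': "(x', d') \<in> set bs" "a \<in> set x'"
        using Cons.prems(4) b nx by auto
      have "2 \<le> d' * count_list x' a"
      proof -
        have "1 \<le> count_list x' a" using x'(2) by (metis One_nat_def Suc_leI count_list_0_iff neq0_conv)
        moreover have "2 \<le> d'" using Cons.prems(3) x'(1) by auto
        ultimately show ?thesis using mult_le_mono[of 2 d' 1 "count_list x' a"] by simp
      qed
      also have "d' * count_list x' a = count_list (concat (replicate d' x')) a"
        by (simp add: count_list_concat_replicate)
      also have "\<dots> \<le> count_list ?R a"
        using count_list_concat_map[OF x'(1), of "\<lambda>(x, d). concat (replicate d x)" a] by simp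
      also have "\<dots> \<le> count_list (window q (length S)) a"
        using subseq_count_le[OF w12(3)] w2 by simp
      finally show False using S3[of a] a q tq[of a] by (simp add: new_letters_iff)
    qed
  qed
  then have is_block: "is_block p q d x" using dist w12(2) w1 by (simp add: is_block_def)
  have "p < q"
  proof (rule ccontr)
    assume "\<not> p < q"
    then have "new_letters p q = {}" by (auto simp: new_letters_def)
    then show False using \<open>set x = new_letters p q\<close> xd by auto
  qed
  from prefix_solution_step[OF Cons.prems(1) this q(2) d is_block] have g: "prefix_solution q (w @ concat (replicate d x))" .
  have "set (concat (replicate d x)) = set x" using xd(2) by auto
  then have "prefix_solution (length S) ((w @ concat (replicate d x)) @ ?R)"
    using Cons.prems b w12(3) w2 by (intro Cons.IH[OF g]) auto
  then show ?case using b by simp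
qed

text \<open>Covering the alphabet forces every letter to occur at least twice. The second conclusion
  is the test that the program makes at its end.\<close>

lemma feasible_imp_prefix_solution:
  assumes "lsrs_plus_feasible {..<m} S w" "set S \<subseteq> {..<m}"
  shows "prefix_solution (length S) w" "new_letters 0 (length S) = {..<m}"
proof -
  from assms(1) obtain bs where bs: "w = concat (map (\<lambda>(x, d). concat (replicate d x)) bs)"
     "\<forall>(x, d) \<in> set bs. x \<noteq> [] \<and> subseq x S \<and> d \<ge> 2" and sub: "subseq w S" and cov: "{..<m} \<subseteq> set w"
    unfolding lsrs_plus_feasible_def is_srs_def by auto
  have mem: "\<exists>(x, d) \<in> set bs. a \<in> set x" if "a \<in> set w" for a
    using that unfolding bs(1) by force
  have "new_letters 0 (length S) \<subseteq> {..<m}" using new_letters_subset_set assms(2) by blast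
  moreover have "a \<in> new_letters 0 (length S)" if "a < m" for a
  proof -
    have "a \<in> set w" using cov that by auto
    from mem[OF this] obtain x d where x: "(x, d) \<in> set bs" "a \<in> set x" by auto
    have "1 \<le> count_list x a" using x(2) by (metis One_nat_def Suc_leI count_list_0_iff neq0_conv)
    moreover have "2 \<le> d" using bs(2) x(1) by auto
    ultimately have "2 \<le> count_list (concat (replicate d x)) a"
      using mult_le_mono[of 2 d 1 "count_list x a"] by (simp add: count_list_concat_replicate)
    also have "\<dots> \<le> count_list w a" unfolding bs(1)
      using count_list_concat_map[OF x(1), of "\<lambda>(x, d). concat (replicate d x)" a] by simp
    also have "\<dots> \<le> count_list S a" using sub by (rule subseq_count_le)
    finally show ?thesis by (simp add: new_letters_iff)
  qed
  ultimately show new_letters: "new_letters 0 (length S) = {..<m}" by auto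
  have "prefix_solution (length S) ([] @ concat (map (\<lambda>(x, d). concat (replicate d x)) bs))"
    by (rule blocks_prefix_solution[OF prefix_solution_0]) (use bs sub mem cov new_letters in \<open>auto simp: window_full simp del: set_concat\<close>)
  then show "prefix_solution (length S) w" using bs by simp
qed

lemma prefix_solution_imp_feasible:
  assumes "prefix_solution (length S) w" "new_letters 0 (length S) = {..<m}" "0 < m"
  shows "lsrs_plus_feasible {..<m} S w"
proof -
  have "set w = {..<m}" using prefix_solution_set assms by simp
  then show ?thesis using prefix_solution_is_srs[OF assms(1)] assms(3) unfolding lsrs_plus_feasible_def by force
qed

text \<open>An SRS has at least one nonempty block, so the empty string is never feasible, although
  \<open>prefix_solution 0 []\<close> holds. The program therefore has to reject the empty alphabet
  explicitly.\<close>

lemma feasible_nonempty_alphabet: "lsrs_plus_feasible {..<m} S w \<Longrightarrow> set S \<subseteq> {..<m} \<Longrightarrow> 0 < m"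
  unfolding lsrs_plus_feasible_def is_srs_def
  by (rule ccontr) (fastforce simp: neq_Nil_conv)


section \<open>Finding blocks by skipping at most one occurrence per letter\<close>

definition kept :: "nat \<Rightarrow> nat \<Rightarrow> (nat \<Rightarrow> nat) \<Rightarrow> nat list" where
  "kept p q sk = filter (\<lambda>i. letter i \<in> new_letters p q \<and> sk (letter i) \<noteq> i) [Suc p..<Suc (length S)]"

abbreviation kept_word :: "nat \<Rightarrow> nat \<Rightarrow> (nat \<Rightarrow> nat) \<Rightarrow> nat list" where
  "kept_word p q sk \<equiv> map letter (kept p q sk)"

definition first_mismatch :: "nat \<Rightarrow> nat list \<Rightarrow> nat \<Rightarrow> bool" where
  "first_mismatch c y j \<longleftrightarrow> j + c < length y \<and> y ! j \<noteq> y ! (j + c) \<and> (\<forall>i<j. y ! i = y ! (i + c))"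

text \<open>Holds for arbitrary skips. The word is a power of its first
  \<open>card (new_letters p q)\<close> letters; as \<open>d \<ge> 2\<close> and no letter occurs
  four times, these letters are distinct, and a subset of \<open>new_letters p q\<close> of full
  cardinality is all of it.\<close>

lemma check_sound:
  assumes pq: "p \<le> q" "q \<le> length S" and d: "2 \<le> d"
    and len: "length (kept p q sk) = d * card (new_letters p q)"
    and per: "\<And>j. j + card (new_letters p q) < length (kept p q sk) \<Longrightarrow> kept_word p q sk ! j = kept_word p q sk ! (j + card (new_letters p q))"
    and last: "\<forall>i \<in> set (kept p q sk). i \<le> q"
  shows "\<exists>x. is_block p q d x \<and> kept_word p q sk = concat (replicate d x)"
proof -
  let ?y = "kept_word p q sk" and ?c = "card (new_letters p q)"
  let ?x = "take ?c ?y"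
  have y: "?y = concat (replicate d ?x)"
    using len per by (intro periodic_eq_concat_replicate) auto
  have "[Suc p..<Suc (length S)] = [Suc p..<Suc q] @ [Suc q..<Suc (length S)]"
    using pq by (rule upt_split)
  moreover have "filter (\<lambda>i. letter i \<in> new_letters p q \<and> sk (letter i) \<noteq> i) [Suc q..<Suc (length S)] = []"
    unfolding filter_empty_conv
  proof (intro ballI notI)
    fix i assume i: "i \<in> set [Suc q..<Suc (length S)]" "letter i \<in> new_letters p q \<and> sk (letter i) \<noteq> i"
    then have "i \<in> set (kept p q sk)" using pq by (auto simp: kept_def simp del: upt_Suc)
    then have "i \<le> q" using last by blast
    then show False using i by simp
  qed
  ultimately have "kept p q sk = filter (\<lambda>i. letter i \<in> new_letters p q \<and> sk (letter i) \<noteq> i) [Suc p..<Suc q]"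
    by (simp only: kept_def filter_append append_Nil2)
  then have sub: "subseq ?y (window p q)"
    by (simp only: window_def) (intro subseq_map subseq_filter_left)
  have "count_list (window p q) a \<le> 3" for a
    using three[of a] window_full window_append[of 0 p q] window_append[of 0 q "length S"] pq
    by (metis count_list_append le0 le_add1 le_add2 order_trans)
  then have dc: "d * count_list ?x a \<le> 3" for a
    using subseq_count_le[OF sub, of a] y by (metis count_list_concat_replicate order_trans)
  have "count_list ?x a \<le> 1" for a
  proof -
    have "2 * count_list ?x a \<le> 3"
      using d mult_le_mono1[of 2 d "count_list ?x a"] dc[of a] by linarith
    then show ?thesis by linarith
  qed
  then have dist: "distinct ?x" by (rule distinct_count_le)
  have "set ?x \<subseteq> new_letters p q"
    using set_take_subset[of ?c ?y] by (auto simp: kept_def)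
  moreover have "card (set ?x) = ?c"
    using dist len d by (simp add: distinct_card)
  ultimately have "set ?x = new_letters p q" by (intro card_subset_eq) auto
  then show ?thesis using dist y sub by (metis is_block_def)
qed

text \<open>A target \<open>e\<close> is an end of a block starting after \<open>p\<close> that the search of one mode must not
  miss: an invariant \<open>J\<close> of the skip function guarantees that no step before \<open>e\<close> gives up.\<close>

definition admissible :: "nat \<Rightarrow> nat \<Rightarrow> nat \<Rightarrow> ((nat \<Rightarrow> nat) \<Rightarrow> bool) \<Rightarrow> bool" where
  "admissible p d e J \<longleftrightarrow> (\<forall>q sk. p < q \<longrightarrow> q \<le> e \<longrightarrow> J sk \<longrightarrow>
     length (kept p q sk) = d * card (new_letters p q) \<and>
     (\<forall>j v. first_mismatch (card (new_letters p q)) (kept_word p q sk) j \<longrightarrow> v = kept_word p q sk ! (j + card (new_letters p q)) \<longrightarrow>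
        sk v \<noteq> o2 v \<and> J (sk(v := o2 v))) \<and>
     (q = e \<longrightarrow> (\<forall>i \<in> set (kept p q sk). i \<le> q)))"

text \<open>The invariant may only rely on the letters of the string, because initialisation sets
  the skips of these letters only.\<close>

definition target :: "nat \<Rightarrow> nat \<Rightarrow> (nat \<Rightarrow> nat) \<Rightarrow> nat \<Rightarrow> bool" where
  "target p d sk0 e \<longleftrightarrow>
     (\<exists>J. (\<forall>sk. (\<forall>a \<in> set S. sk a = sk0 a) \<longrightarrow> J sk) \<and> admissible p d e J)"

text \<open>\<open>r = 0\<close> codes the search for cubes: position 0 does not exist, so nothing
  is skipped. For positive \<open>r\<close> the skipped occurrence is the one that leaves the short
  pair on both sides of \<open>r\<close>. If \<open>o3 a = 0\<close>, skipping it removes nothing;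
  pairs that cannot be formed show up as a wrong length.\<close>

definition skip0 :: "nat \<Rightarrow> nat \<Rightarrow> nat" where
  "skip0 r a = (if r = 0 then 0 else if o2 a \<le> r then o1 a else o3 a)"

lemma new_letters_mono: "q \<le> e \<Longrightarrow> new_letters p q \<subseteq> new_letters p e"
  by (auto simp: new_letters_def)

lemma letter_in_S: "Suc 0 \<le> i \<Longrightarrow> i \<le> length S \<Longrightarrow> letter i \<in> set S"
  unfolding letter_def by (metis One_nat_def Suc_le_eq Suc_pred nth_mem)

text \<open>A cube spends all three occurrences of its letters. Its restriction to the letters new
  at an earlier \<open>q\<close> is therefore the whole kept word and again a cube, so no mismatch
  ever arises and the invariant is simply that nothing is skipped.\<close>

lemma cube_target:
  assumes is_block: "is_block p e 3 x" and pe: "p < e" "e \<le> length S"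
  shows "target p 3 (skip0 0) e"
  unfolding target_def
proof (intro exI conjI allI impI)
  let ?J = "\<lambda>sk :: nat \<Rightarrow> nat. \<forall>a \<in> set S. sk a = 0"
  show "?J sk" if "\<forall>a \<in> set S. sk a = skip0 0 a" for sk
    using that by (simp add: skip0_def)
  have "length (kept p q sk) = 3 * card (new_letters p q) \<and>
      (\<forall>j. \<not> first_mismatch (card (new_letters p q)) (kept_word p q sk) j) \<and>
      (q = e \<longrightarrow> (\<forall>i \<in> set (kept p q sk). i \<le> q))"
    if q: "p < q" "q \<le> e" and J: "?J sk" for q sk
  proof -
    let ?z = "filter (\<lambda>a. a \<in> new_letters p q) x"
    have Lx: "new_letters p q \<subseteq> set x" using is_block new_letters_mono[OF q(2)] by (auto simp: is_block_def)
    have lz: "length ?z = card (new_letters p q)"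
    proof -
      have "distinct ?z" using is_block by (simp add: is_block_def)
      moreover have "set ?z = new_letters p q" using Lx by auto
      ultimately show ?thesis by (metis distinct_card)
    qed
    have fc: "filter P (concat (replicate d x)) = concat (replicate d (filter P x))" for P d
      by (induction d) auto
    let ?A = "filter (\<lambda>i. letter i \<in> new_letters p q) [Suc p..<Suc e]"
    let ?B = "filter (\<lambda>i. letter i \<in> new_letters p q) [Suc e..<Suc (length S)]"
    have kept: "kept p q sk = ?A @ ?B"
    proof -
      have "kept p q sk = filter (\<lambda>i. letter i \<in> new_letters p q) [Suc p..<Suc (length S)]"
        unfolding kept_def using J by (intro filter_cong) (auto simp: letter_in_S simp del: upt_Suc)
      then show ?thesis using pe by (simp add: upt_split[of p e "length S"] del: upt_Suc)
    qed
    have "subseq (filter (\<lambda>a. a \<in> new_letters p q) (concat (replicate 3 x))) (filter (\<lambda>a. a \<in> new_letters p q) (window p e))"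
      using is_block by (intro subseq_filter) (simp add: is_block_def)
    moreover have "filter (\<lambda>a. a \<in> new_letters p q) (window p e) = map letter ?A"
      by (simp add: window_def filter_map o_def)
    ultimately have sub: "subseq (concat (replicate 3 ?z)) (map letter ?A)" by (simp only: fc)
    have l3: "length (concat (replicate 3 ?z)) = 3 * card (new_letters p q)"
      using lz by (simp add: length_concat sum_list_replicate)
    have "length (map letter (?A @ ?B)) \<le> length (filter (\<lambda>a. a \<in> new_letters p q) S)"
    proof -
      have "window 0 (length S) = window 0 p @ window p (length S)" using pe by (simp add: window_append)
      then have "length (filter (\<lambda>a. a \<in> new_letters p q) (window p (length S))) \<le> length (filter (\<lambda>a. a \<in> new_letters p q) S)"
        by (metis filter_append length_append le_add2 window_full)
      moreover have "filter (\<lambda>a. a \<in> new_letters p q) (window p (length S)) = map letter (?A @ ?B)"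
        using pe by (simp add: upt_split[of p e "length S"] window_def filter_map o_def del: upt_Suc)
      ultimately show ?thesis by simp
    qed
    also have "\<dots> = (\<Sum>a\<in>new_letters p q. count_list S a)" by (rule length_filter_eq_sum_count) simp
    also have "\<dots> \<le> (\<Sum>a\<in>new_letters p q. 3)" by (intro sum_mono three)
    finally have AB: "length ?A + length ?B \<le> 3 * card (new_letters p q)" by (simp del: upt_Suc)
    \<comment> \<open>The counts bound the kept positions from above, the embedding bounds those up
      to \<open>e\<close> from below by the same number. Hence none lies behind \<open>e\<close>,
      and the embedding is onto.\<close>
    have "3 * card (new_letters p q) \<le> length ?A"
      using list_emb_length[OF sub] l3 by simp
    with AB have "length ?B = 0" and A: "length ?A = 3 * card (new_letters p q)" by linarith+
    then have B: "?B = []" by (simp only: length_0_conv)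
    have "concat (replicate 3 ?z) = map letter ?A"
      using l3 A by (intro subseq_same_length[OF sub]) simp
    then have kept_word: "kept_word p q sk = ?z @ ?z @ ?z" using kept B by (simp add: numeral_3_eq_3 del: upt_Suc)
    have "\<not> first_mismatch (card (new_letters p q)) (kept_word p q sk) j" for j
      unfolding kept_word first_mismatch_def using lz by (auto simp: nth_append)
    then show ?thesis using kept A B by (auto simp del: upt_Suc)
  qed
  then show "admissible p 3 e ?J" unfolding admissible_def by blast
qed

text \<open>Distinctness of \<open>x\<close> allows the embedding to be read as a function of
  letters; two such functions give each letter of a square its pair of positions.\<close>

lemma subseq_positions:
  assumes "subseq x (window p r)" "distinct x"
  obtains f where "\<And>a. a \<in> set x \<Longrightarrow> p < f a \<and> f a \<le> r \<and> letter (f a) = a"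
    "\<And>i j. i < j \<Longrightarrow> j < length x \<Longrightarrow> f (x ! i) < f (x ! j)"
proof -
  obtain zs where zs: "subseq zs [Suc p..<Suc r]" "map letter zs = x"
    using assms(1) unfolding window_def by (rule subseq_mapD)
  have sorted: "sorted_wrt (<) zs" by (rule strict_sorted_subseq[OF zs(1) strict_sorted_upt])
  have set: "set zs \<subseteq> {p<..r}"
  proof -
    have "set zs \<subseteq> set [Suc p..<Suc r]"
      using zs(1) by (metis notin_set_nthsI subseq_conv_nths subsetI)
    then show ?thesis by auto
  qed
  have inj: "inj_on letter (set zs)" using zs(2) assms(2) by (metis distinct_map)
  let ?f = "inv_into (set zs) letter"
  have f: "?f (x ! i) = zs ! i" if "i < length x" for i
    using that zs(2) inj by (metis inv_into_f_f length_map nth_map nth_mem)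
  show ?thesis
  proof (rule that[of ?f])
    fix a assume "a \<in> set x"
    then have "a \<in> letter ` set zs" using zs(2) by (metis list.set_map)
    then have "?f a \<in> set zs" "letter (?f a) = a" by (auto simp: inv_into_into f_inv_into_f)
    then show "p < ?f a \<and> ?f a \<le> r \<and> letter (?f a) = a" using set by auto
  next
    fix i j assume "i < j" "j < length x"
    then show "?f (x ! i) < ?f (x ! j)"
      using f sorted zs(2) by (auto simp: sorted_wrt_iff_nth_less)
  qed
qed

text \<open>Every letter of a square block is used at one of the three pairs of its occurrences.  The split
  point \<open>r\<close> leaves only two of them: a short pair and the pair of the outer occurrences.  A letter
  whose short pair is nested in the pair of another letter has to be widened, and widening is never
  undone, so starting from short pairs only forced widenings are made.\<close>

lemma square_target:
  assumes is_block: "is_block p e 2 x" and pe: "p < e" "e \<le> length S"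
  shows "\<exists>r \<in> {1..length S}. target p 2 (skip0 r) e"
proof (cases "x = []")
  case True
  then have "new_letters p e = {}" using is_block by (simp add: is_block_def)
  then have new_letters: "new_letters p q = {}" if "q \<le> e" for q using new_letters_mono[OF that, of p] by blast
  \<comment> \<open>No letter is new up to \<open>e\<close>, so all words are empty and every
    positive split point serves.\<close>
  have "admissible p 2 e (\<lambda>_. True)"
    unfolding admissible_def
  proof (intro allI impI)
    fix q sk assume "q \<le> e"
    then have "new_letters p q = {}" by (rule new_letters)
    then have "kept p q sk = []" by (simp add: kept_def del: upt_Suc)
    then have "\<forall>i \<in> set (kept p q sk). i \<le> q" "length (kept p q sk) = 2 * card (new_letters p q)"
      "\<not> first_mismatch (card (new_letters p q)) (kept_word p q sk) j" for j
      using \<open>new_letters p q = {}\<close> by (simp_all add: first_mismatch_def)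
    then show "length (kept p q sk) = 2 * card (new_letters p q) \<and>
      (\<forall>j v. first_mismatch (card (new_letters p q)) (kept_word p q sk) j \<longrightarrow> v = kept_word p q sk ! (j + card (new_letters p q)) \<longrightarrow>
        sk v \<noteq> o2 v \<and> True) \<and> (q = e \<longrightarrow> (\<forall>i \<in> set (kept p q sk). i \<le> q))"
      by blast
  qed
  then have "target p 2 (skip0 1) e" unfolding target_def by (intro exI[of _ "\<lambda>_. True"]) simp
  moreover have "1 \<in> {1..length S}" using pe by simp
  ultimately show ?thesis by (rule bexI)
next
  case False
  have setx: "set x = new_letters p e" and distx: "distinct x" using is_block by (auto simp: is_block_def)
  have "subseq (x @ x) (window p e)" using is_block by (simp add: is_block_def numeral_2_eq_2)
  then obtain w1 w2 where w12: "window p e = w1 @ w2" "subseq x w1" "subseq x w2"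
    by (meson list_emb_appendD)
  define r where "r = p + length w1"
  have r: "p \<le> r" "r \<le> e"
    using arg_cong[OF w12(1), of length] pe by (auto simp: r_def length_window)
  have "w1 @ w2 = window p r @ window r e" using w12 r by (simp add: window_append)
  moreover have "length w1 = length (window p r)" by (simp add: length_window r_def)
  ultimately have w: "w1 = window p r" "w2 = window r e" by simp_all
  have "w1 \<noteq> []" using w12(2) False by auto
  \<comment> \<open>Split point 0 is reserved for cubes.\<close>
  then have r1: "1 \<le> r" by (cases w1) (auto simp: r_def)
  obtain f where f: "\<And>a. a \<in> set x \<Longrightarrow> p < f a \<and> f a \<le> r \<and> letter (f a) = a"
    "\<And>i j. i < j \<Longrightarrow> j < length x \<Longrightarrow> f (x ! i) < f (x ! j)"
    using subseq_positions[of x p r] w12(2) w distx by metis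
  obtain g where g: "\<And>a. a \<in> set x \<Longrightarrow> r < g a \<and> g a \<le> e \<and> letter (g a) = a"
    "\<And>i j. i < j \<Longrightarrow> j < length x \<Longrightarrow> g (x ! i) < g (x ! j)"
    using subseq_positions[of x r e] w12(3) w distx by metis
  have fg: "g u < g v" if uv: "u \<in> set x" "v \<in> set x" "f u < f v" for u v
  proof -
    obtain i j where ij: "i < length x" "x ! i = u" "j < length x" "x ! j = v"
      using uv(1,2) by (metis in_set_conv_nth)
    have "i < j" using f(2)[of j i] ij uv(3) by (metis less_asym linorder_neqE_nat order.irrefl)
    then show ?thesis using g(2)[of i j] ij by auto
  qed
  \<comment> \<open>A letter still has its initial short pair, or it has been widened and then the
    given solution \<open>f\<close>, \<open>g\<close> uses its outer pair as well: only forced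
    widenings have been made.\<close>
  let ?J = "\<lambda>sk. \<forall>a \<in> set x. sk a = skip0 r a \<or> (sk a = o2 a \<and> f a = o1 a \<and> g a = o3 a)"
  have init: "?J sk" if "\<forall>a \<in> set S. sk a = skip0 r a" for sk
    using that setx new_letters_subset_set by blast
  have "length (kept p q sk) = 2 * card (new_letters p q) \<and>
     (\<forall>j v. first_mismatch (card (new_letters p q)) (kept_word p q sk) j \<longrightarrow> v = kept_word p q sk ! (j + card (new_letters p q)) \<longrightarrow>
        sk v \<noteq> o2 v \<and> ?J (sk(v := o2 v))) \<and>
     (q = e \<longrightarrow> (\<forall>i \<in> set (kept p q sk). i \<le> q))"
    if q: "p < q" "q \<le> e" and J: "?J sk" for q sk
  proof -
    let ?L = "new_letters p q" and ?c = "card (new_letters p q)"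
    \<comment> \<open>\<open>F a\<close> and \<open>G a\<close> are the positions of
      \<open>a\<close> that the current skips leave to the first and the second copy. By
      \<open>FG\<close> below, this pair always lies within the pair \<open>f a\<close>,
      \<open>g a\<close> of the solution, and can differ from it only while \<open>a\<close> still
      waits to be widened.\<close>
    define F where "F = (\<lambda>a. if sk a = o1 a then o2 a else o1 a)"
    define G where "G = (\<lambda>a. if sk a = o3 a then o2 a else o3 a)"
    have Lx: "?L \<subseteq> set x" using setx new_letters_mono[OF q(2)] by auto
    have fcase: "f a = o1 a \<or> f a = o2 a \<or> f a = o3 a" "g a = o1 a \<or> g a = o2 a \<or> g a = o3 a"
      if "a \<in> set x" for a
    proof -
      have "1 \<le> f a" "f a \<le> length S" "1 \<le> g a" "g a \<le> length S" "letter (f a) = a" "letter (g a) = a"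
        using f(1)[OF that] g(1)[OF that] pe r by auto
      then show "f a = o1 a \<or> f a = o2 a \<or> f a = o3 a" "g a = o1 a \<or> g a = o2 a \<or> g a = o3 a"
        using occurrence_cases[of "f a"] occurrence_cases[of "g a"] by simp_all
    qed
    have FG: "p < F a \<and> F a \<le> r \<and> r < G a \<and> G a \<le> g a \<and> f a \<le> F a \<and> letter (F a) = a \<and> letter (G a) = a \<and>
        F a \<noteq> sk a \<and> G a \<noteq> sk a \<and>
        (\<forall>i. p < i \<longrightarrow> i \<le> length S \<longrightarrow> letter i = a \<longrightarrow> i \<noteq> sk a \<longrightarrow> i = F a \<or> i = G a) \<and>
        ((f a = o1 a \<and> g a = o3 a \<and> sk a \<noteq> o2 a) \<or> (F a = f a \<and> G a = g a))"
      if a: "a \<in> ?L" for a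
    proof -
      have ax: "a \<in> set x" using Lx a by auto
      note o = new_letters_occ[OF a]
      have o13: "i = o1 a \<or> i = o2 a \<or> i = o3 a" if "p < i" "i \<le> length S" "letter i = a" for i
        using occurrence_cases[of i] that by auto
      have sk: "sk a = (if o2 a \<le> r then o1 a else o3 a) \<or> (sk a = o2 a \<and> f a = o1 a \<and> g a = o3 a)"
        using J ax r1 by (auto simp: skip0_def)
      have "p < F a \<and> F a \<le> r \<and> r < G a \<and> G a \<le> g a \<and> f a \<le> F a \<and> letter (F a) = a \<and> letter (G a) = a \<and>
        F a \<noteq> sk a \<and> G a \<noteq> sk a \<and>
        ((f a = o1 a \<and> g a = o3 a \<and> sk a \<noteq> o2 a) \<or> (F a = f a \<and> G a = g a))"
      proof -
        have "f a = o1 a \<and> g a = o2 a \<and> r < o2 a \<or> f a = o1 a \<and> g a = o3 a \<and> 0 < o3 a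
            \<or> f a = o2 a \<and> g a = o3 a \<and> 0 < o3 a \<and> o2 a \<le> r"
          using f(1)[OF ax] g(1)[OF ax] fcase[OF ax] o(1,2,6) by (elim disjE) auto
        then show ?thesis
          using sk f(1)[OF ax] g(1)[OF ax] o unfolding F_def G_def
          by (elim disjE conjE) (auto split: if_splits)
      qed
      moreover have "i = F a \<or> i = G a" if "p < i" "i \<le> length S" "letter i = a" "i \<noteq> sk a" for i
        using o13[OF that(1-3)] that(4) sk unfolding F_def G_def by (auto split: if_splits)
      ultimately show ?thesis by blast
    qed
    have cover: "i = F a \<or> i = G a" if "a \<in> ?L" "p < i" "i \<le> length S" "letter i = a" "i \<noteq> sk a" for a i
      using FG[OF that(1)] that(2-) by blast
    let ?P = "\<lambda>i. letter i \<in> ?L \<and> sk (letter i) \<noteq> i"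
    define U where "U = filter ?P [Suc p..<Suc r]"
    define V where "V = filter ?P [Suc r..<Suc (length S)]"
    have ysUV: "kept p q sk = U @ V"
      unfolding kept_def U_def V_def using upt_split[of p r "length S"] r pe by simp
    have gS: "G a \<le> length S" if "a \<in> ?L" for a
      using FG[OF that] g(1)[of a] Lx that pe by force
    have setU: "set U = F ` ?L"
    proof (intro equalityI subsetI)
      fix i assume i: "i \<in> set U"
      then have *: "letter i \<in> ?L" "p < i" "i \<le> r" "i \<noteq> sk (letter i)" by (auto simp: U_def simp del: upt_Suc)
      then have "p < i" "i \<le> length S" using r pe by linarith+
      then have "i = F (letter i) \<or> i = G (letter i)" using cover[OF *(1) _ _ refl *(4)] by blast
      moreover have "r < G (letter i)" using FG[OF *(1)] by blast
      ultimately have "i = F (letter i)" using *(3) by linarith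
      then show "i \<in> F ` ?L" using * by blast
    next
      fix i assume "i \<in> F ` ?L"
      then obtain a where a: "a \<in> ?L" "i = F a" by auto
      then show "i \<in> set U" using FG[OF a(1)] by (auto simp: U_def simp del: upt_Suc)
    qed
    have setV: "set V = G ` ?L"
    proof (intro equalityI subsetI)
      fix i assume i: "i \<in> set V"
      then have *: "letter i \<in> ?L" "r < i" "i \<le> length S" "i \<noteq> sk (letter i)" by (auto simp: V_def simp del: upt_Suc)
      then have "p < i" "i \<le> length S" using r pe by linarith+
      then have "i = F (letter i) \<or> i = G (letter i)" using cover[OF *(1) _ _ refl *(4)] by blast
      moreover have "F (letter i) \<le> r" using FG[OF *(1)] by blast
      ultimately have "i = G (letter i)" using *(2) by linarith
      then show "i \<in> G ` ?L" using * by blast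
    next
      fix i assume "i \<in> G ` ?L"
      then obtain a where a: "a \<in> ?L" "i = G a" by auto
      then show "i \<in> set V" using FG[OF a(1)] gS[OF a(1)] by (auto simp: V_def simp del: upt_Suc)
    qed
    have dU: "sorted_wrt (<) U" "sorted_wrt (<) V"
      unfolding U_def V_def by (rule strict_sorted_subseq[OF subseq_filter_left strict_sorted_upt])+
    then have dist: "distinct U" "distinct V" by (simp_all add: strict_sorted_iff)
    have inj: "inj_on F ?L" "inj_on G ?L" using FG by (metis inj_onI)+
    have lU: "length U = ?c" using dist setU inj by (metis card_image distinct_card)
    have lV: "length V = ?c" using dist setV inj by (metis card_image distinct_card)
    have U: "letter (U ! k) \<in> ?L \<and> F (letter (U ! k)) = U ! k" if "k < ?c" for k
      using nth_mem[of k U] that lU setU FG by auto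
    have V: "letter (V ! k) \<in> ?L \<and> G (letter (V ! k)) = V ! k" if "k < ?c" for k
      using nth_mem[of k V] that lV setV FG by auto
    have "sk v \<noteq> o2 v \<and> ?J (sk(v := o2 v))"
      if fm: "first_mismatch ?c (kept_word p q sk) j" and v: "v = kept_word p q sk ! (j + ?c)" for j v
    proof -
      have j: "j < ?c" using fm lU lV by (auto simp: first_mismatch_def ysUV)
      have yw1: "kept_word p q sk ! k = letter (U ! k)" "kept_word p q sk ! (k + ?c) = letter (V ! k)" if "k < ?c" for k
        using that lU lV by (auto simp: ysUV nth_append)
      define u where "u = letter (U ! j)"
      have v: "v = letter (V ! j)" using v yw1 j by simp
      have uL: "u \<in> ?L" "F u = U ! j" and vL: "v \<in> ?L" "G v = V ! j"
        using U[OF j] V[OF j] by (auto simp: u_def v)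
      have uv: "u \<noteq> v" using fm yw1[OF j] by (simp add: first_mismatch_def u_def v)
      have eq: "letter (U ! k) = letter (V ! k)" if "k < j" for k
        using fm that yw1[of k] j unfolding first_mismatch_def by (metis less_trans)
      \<comment> \<open>Before index \<open>j\<close> the two copies list the same letters, and each
        letter occurs once per copy. So \<open>v\<close> follows \<open>u\<close> in the first copy
        and \<open>u\<close> follows \<open>v\<close> in the second: the pair of \<open>v\<close> is
        nested strictly inside that of \<open>u\<close>.\<close>
      obtain k where k: "k < ?c" "U ! k = F v"
        using vL(1) setU lU by (metis imageI in_set_conv_nth)
      have "j < k"
      proof (rule ccontr)
        assume "\<not> j < k"
        moreover have "k \<noteq> j" using k uL uv FG[OF uL(1)] FG[OF vL(1)] by metis
        ultimately have "k < j" by simp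
        then have "letter (V ! k) = v" using eq k FG[OF vL(1)] by metis
        then have "V ! k = V ! j" using V[OF k(1)] vL by metis
        then show False using \<open>k < j\<close> dist lV j k by (simp add: nth_eq_iff_index_eq)
      qed
      then have Fuv: "F u < F v" using dU(1) k lU uL by (simp add: sorted_wrt_iff_nth_less flip: k(2))
      obtain k' where k': "k' < ?c" "V ! k' = G u"
        using uL(1) setV lV by (metis imageI in_set_conv_nth)
      have "j < k'"
      proof (rule ccontr)
        assume "\<not> j < k'"
        moreover have "k' \<noteq> j" using k' vL uv FG[OF uL(1)] FG[OF vL(1)] by metis
        ultimately have "k' < j" by simp
        then have "letter (U ! k') = u" using eq k' FG[OF uL(1)] by metis
        then have "U ! k' = U ! j" using U[OF k'(1)] uL by metis
        then show False using \<open>k' < j\<close> dist lU j k' by (simp add: nth_eq_iff_index_eq)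
      qed
      then have Guv: "G v < G u" using dU(2) k' lV vL by (simp add: sorted_wrt_iff_nth_less flip: k'(2))
      \<comment> \<open>If \<open>v\<close> already had its final pair,
        \<open>f u \<le> F u < F v = f v\<close> would give
        \<open>g u < g v = G v < G u \<le> g u\<close>. So it is \<open>v\<close> that the solution
        widens.\<close>
      have "f v = o1 v \<and> g v = o3 v \<and> sk v \<noteq> o2 v"
      proof (rule ccontr)
        assume "\<not> ?thesis"
        then have "F v = f v" "G v = g v" using FG[OF vL(1)] by auto
        moreover have "f u \<le> F u" "G u \<le> g u" using FG[OF uL(1)] by auto
        moreover have "g u < g v" if "f u < f v" using fg that uL vL Lx by auto
        ultimately show False using Fuv Guv by simp
      qed
      then show ?thesis using J by simp
    qed
    moreover have "i \<le> q" if qi: "q = e" "i \<in> set (kept p q sk)" for i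
    proof -
      obtain a where a: "a \<in> ?L" "i = F a \<or> i = G a"
        using qi(2) setU setV ysUV by auto
      have "F a \<le> r" "G a \<le> g a" using FG[OF a(1)] by blast+
      moreover have "g a \<le> e" using g(1)[of a] a(1) Lx by blast
      ultimately show ?thesis using a(2) r qi(1) by linarith
    qed
    moreover have "length (kept p q sk) = 2 * ?c" using ysUV lU lV by simp
    ultimately show ?thesis by blast
  qed
  then have "admissible p 2 e ?J" unfolding admissible_def by blast
  then have "target p 2 (skip0 r) e" unfolding target_def using init by (intro exI[of _ ?J]) simp
  then show ?thesis using r r1 pe by (intro bexI[of _ r]) auto
qed

end

section \<open>Time-bounded total correctness\<close>

definition bnd :: "nat \<Rightarrow> state \<Rightarrow> bool" where
  "bnd W s \<longleftrightarrow> (\<forall>x. reg s x < W) \<and> (\<forall>A i. arr s A i < W)"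

text \<open>What remains of \<open>afits\<close> once \<open>bnd\<close> holds: loaded values fit
  anyway, so only constants, sums and products have to be checked.\<close>

fun safe :: "nat \<Rightarrow> aexp \<Rightarrow> state \<Rightarrow> bool" where
  "safe W (Const k) s \<longleftrightarrow> k < W"
| "safe W (Reg x) s \<longleftrightarrow> True"
| "safe W (Load A i) s \<longleftrightarrow> safe W i s"
| "safe W (Plus a b) s \<longleftrightarrow> safe W a s \<and> safe W b s \<and> aval a s + aval b s < W"
| "safe W (Minus a b) s \<longleftrightarrow> safe W a s \<and> safe W b s"
| "safe W (Times a b) s \<longleftrightarrow> safe W a s \<and> safe W b s \<and> aval a s * aval b s < W"

fun bsafe :: "nat \<Rightarrow> bexp \<Rightarrow> state \<Rightarrow> bool" where
  "bsafe W (Less a b) s \<longleftrightarrow> safe W a s \<and> safe W b s"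
| "bsafe W (Equal a b) s \<longleftrightarrow> safe W a s \<and> safe W b s"
| "bsafe W (Not b) s \<longleftrightarrow> bsafe W b s"
| "bsafe W (And b c) s \<longleftrightarrow> bsafe W b s \<and> bsafe W c s"

lemma safe_afits: "bnd W s \<Longrightarrow> safe W a s \<Longrightarrow> afits W a s"
  by (induction a) (auto simp: bnd_def)

lemma bsafe_bfits: "bnd W s \<Longrightarrow> bsafe W b s \<Longrightarrow> bfits W b s"
  by (induction b) (auto simp: safe_afits)

lemma afits_less: "afits W a s \<Longrightarrow> aval a s < W"
  by (induction a) auto

lemma exec_bnd: "exec W c s t s' \<Longrightarrow> bnd W s \<Longrightarrow> bnd W s'"
  by (induction rule: exec.induct) (auto simp: bnd_def afits_less)

text \<open>A total-correctness statement for one start state, with \<open>t\<close> as an upper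
  bound of the time. Having \<open>bnd\<close> on both sides keeps the word bound out of all loop
  invariants.\<close>

definition runs :: "nat \<Rightarrow> com \<Rightarrow> nat \<Rightarrow> state \<Rightarrow> (state \<Rightarrow> bool) \<Rightarrow> bool" where
  "runs W c t s Q \<longleftrightarrow> (bnd W s \<longrightarrow> (\<exists>t' s'. exec W c s t' s' \<and> t' \<le> t \<and> bnd W s' \<and> Q s'))"

lemma runs_mono:
  "runs W c t s Q \<Longrightarrow> t \<le> t' \<Longrightarrow> (\<And>s'. bnd W s' \<Longrightarrow> Q s' \<Longrightarrow> Q' s') \<Longrightarrow> runs W c t' s Q'"
  unfolding runs_def by (meson order_trans)

lemma runs_Seq:
  assumes "runs W c1 u s R" "\<And>s'. bnd W s' \<Longrightarrow> R s' \<Longrightarrow> runs W c2 v s' Q" "u + v \<le> t"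
  shows "runs W (Seq c1 c2) t s Q"
  unfolding runs_def
proof
  assume "bnd W s"
  then obtain u1 s1 where 1: "exec W c1 s u1 s1" "u1 \<le> u" "bnd W s1" "R s1"
    using assms(1) unfolding runs_def by blast
  then obtain u2 s2 where 2: "exec W c2 s1 u2 s2" "u2 \<le> v" "bnd W s2" "Q s2"
    using assms(2) unfolding runs_def by blast
  show "\<exists>t' s'. exec W (Seq c1 c2) s t' s' \<and> t' \<le> t \<and> bnd W s' \<and> Q s'"
    using exec.Seq[OF 1(1) 2(1)] 1 2 assms(3)
    by (intro exI[of _ "u1 + u2"] exI[of _ s2]) auto
qed

lemma runs_If:
  assumes "bnd W s \<Longrightarrow> bsafe W b s"
    "bval b s \<Longrightarrow> runs W c1 u s Q" "\<not> bval b s \<Longrightarrow> runs W c2 u s Q" "1 + bcost b + u \<le> t"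
  shows "runs W (If b c1 c2) t s Q"
  unfolding runs_def
proof
  assume bnd: "bnd W s"
  then have f: "bfits W b s" using assms(1) bsafe_bfits by blast
  show "\<exists>t' s'. exec W (If b c1 c2) s t' s' \<and> t' \<le> t \<and> bnd W s' \<and> Q s'"
  proof (cases "bval b s")
    case True
    then obtain k s' where "exec W c1 s k s'" "k \<le> u" "bnd W s'" "Q s'"
      using assms(2) bnd unfolding runs_def by blast
    then show ?thesis using exec.IfTrue[OF f True] assms(4)
      by (intro exI[of _ "1 + bcost b + k"] exI[of _ s']) auto
  next
    case False
    then obtain k s' where "exec W c2 s k s'" "k \<le> u" "bnd W s'" "Q s'"
      using assms(3) bnd unfolding runs_def by blast
    then show ?thesis using exec.IfFalse[OF f False] assms(4)
      by (intro exI[of _ "1 + bcost b + k"] exI[of _ s']) auto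
  qed
qed

text \<open>\<open>\<mu>\<close> bounds the number of rounds; the additional 1 in the time pays for
  the final failing test.\<close>

lemma runs_While:
  assumes I: "I s"
    and safe: "\<And>s. I s \<Longrightarrow> bnd W s \<Longrightarrow> bsafe W b s"
    and body: "\<And>s. I s \<Longrightarrow> bnd W s \<Longrightarrow> bval b s \<Longrightarrow> runs W c t s (\<lambda>s'. I s' \<and> \<mu> s' < (\<mu> s :: nat))"
    and time: "(\<mu> s + 1) * (1 + bcost b + t) \<le> t'"
    and post: "\<And>s'. I s' \<Longrightarrow> bnd W s' \<Longrightarrow> \<not> bval b s' \<Longrightarrow> Q s'"
  shows "runs W (While b c) t' s Q"
proof -
  have "\<exists>u s'. exec W (While b c) s u s' \<and> u \<le> (\<mu> s + 1) * (1 + bcost b + t) \<and> bnd W s' \<and> Q s'"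
    if "I s" "bnd W s" for s
    using that
  proof (induction "\<mu> s" arbitrary: s rule: less_induct)
    case less
    have f: "bfits W b s" using safe less.prems bsafe_bfits by blast
    show ?case
    proof (cases "bval b s")
      case False
      then show ?thesis using exec.WhileFalse[OF f False] post less.prems
        by (intro exI[of _ "1 + bcost b"] exI[of _ s]) auto
    next
      case True
      obtain u1 s1 where 1: "exec W c s u1 s1" "u1 \<le> t" "bnd W s1" "I s1" "\<mu> s1 < \<mu> s"
        using body[OF less.prems True] less.prems(2) unfolding runs_def by blast
      obtain u2 s2 where 2: "exec W (While b c) s1 u2 s2"
          "u2 \<le> (\<mu> s1 + 1) * (1 + bcost b + t)" "bnd W s2" "Q s2"
        using less.hyps[OF 1(5,4,3)] by blast
      have "u2 \<le> \<mu> s * (1 + bcost b + t)"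
        using 2(2) mult_le_mono1[of "\<mu> s1 + 1" "\<mu> s" "1 + bcost b + t"] 1(5) by linarith
      moreover have "(\<mu> s + 1) * (1 + bcost b + t) = \<mu> s * (1 + bcost b + t) + (1 + bcost b + t)"
        by (simp add: algebra_simps)
      ultimately have "1 + bcost b + u1 + u2 \<le> (\<mu> s + 1) * (1 + bcost b + t)"
        using 1(2) by linarith
      then show ?thesis using exec.WhileTrue[OF f True 1(1) 2(1)] 2 by blast
    qed
  qed
  then show ?thesis unfolding runs_def using I time order_trans by blast
qed

text \<open>Commands without loops get a functional semantics (\<open>step\<close>,
  \<open>csafe\<close>, \<open>ccost\<close>), so that loop bodies are verified by simplification
  alone.\<close>

fun loop_free :: "com \<Rightarrow> bool" where
  "loop_free (Seq c d) \<longleftrightarrow> loop_free c \<and> loop_free d"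
| "loop_free (If b c d) \<longleftrightarrow> loop_free c \<and> loop_free d"
| "loop_free (While b c) \<longleftrightarrow> False"
| "loop_free _ \<longleftrightarrow> True"

fun step :: "com \<Rightarrow> state \<Rightarrow> state" where
  "step Skip s = s"
| "step (Assign x a) s = s\<lparr>reg := (reg s)(x := aval a s)\<rparr>"
| "step (Store A i a) s = s\<lparr>arr := (arr s)(A := (arr s A)(aval i s := aval a s))\<rparr>"
| "step (Seq c d) s = step d (step c s)"
| "step (If b c d) s = (if bval b s then step c s else step d s)"
| "step (While b c) s = s"

fun csafe :: "nat \<Rightarrow> com \<Rightarrow> state \<Rightarrow> bool" where
  "csafe W Skip s \<longleftrightarrow> True"
| "csafe W (Assign x a) s \<longleftrightarrow> safe W a s"
| "csafe W (Store A i a) s \<longleftrightarrow> safe W i s \<and> safe W a s"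
| "csafe W (Seq c d) s \<longleftrightarrow> csafe W c s \<and> csafe W d (step c s)"
| "csafe W (If b c d) s \<longleftrightarrow> bsafe W b s \<and> (if bval b s then csafe W c s else csafe W d s)"
| "csafe W (While b c) s \<longleftrightarrow> True"

fun ccost :: "com \<Rightarrow> nat" where
  "ccost Skip = 1"
| "ccost (Assign x a) = 1 + acost a"
| "ccost (Store A i a) = 1 + acost i + acost a"
| "ccost (Seq c d) = ccost c + ccost d"
| "ccost (If b c d) = 1 + bcost b + max (ccost c) (ccost d)"
| "ccost (While b c) = 0"

lemma loop_free_exec:
  "loop_free c \<Longrightarrow> bnd W s \<Longrightarrow> csafe W c s \<Longrightarrow> \<exists>u \<le> ccost c. exec W c s u (step c s)"
proof (induction c arbitrary: s)
  case Skip
  show ?case using exec.Skip by auto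
next
  case (Assign x a)
  then show ?case using exec.Assign[OF safe_afits] by auto
next
  case (Store A i a)
  then show ?case using exec.Store[OF safe_afits safe_afits] by auto
next
  case (Seq c d)
  then obtain u where u: "u \<le> ccost c" "exec W c s u (step c s)" by auto
  with Seq exec_bnd obtain v where v: "v \<le> ccost d" "exec W d (step c s) v (step d (step c s))"
    by (metis csafe.simps(4) loop_free.simps(1))
  show ?case using exec.Seq[OF u(2) v(2)] u v by (auto intro!: exI[of _ "u + v"])
next
  case (If b c d)
  have f: "bfits W b s" using If.prems bsafe_bfits by auto
  show ?case
  proof (cases "bval b s")
    case True
    then obtain u where "u \<le> ccost c" "exec W c s u (step c s)" using If by auto
    with True show ?thesis using exec.IfTrue[OF f True]
      by (auto intro!: exI[of _ "1 + bcost b + u"] simp del: plus_1_eq_Suc)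
  next
    case False
    then obtain u where "u \<le> ccost d" "exec W d s u (step d s)" using If by auto
    with False show ?thesis using exec.IfFalse[OF f False]
      by (auto intro!: exI[of _ "1 + bcost b + u"] simp del: plus_1_eq_Suc)
  qed
qed auto

lemma runs_step:
  assumes "loop_free c" "bnd W s \<Longrightarrow> csafe W c s" "ccost c \<le> t" "Q (step c s)"
  shows "runs W c t s Q"
  using loop_free_exec[OF assms(1) _ assms(2)] assms(3,4) exec_bnd unfolding runs_def
  by (meson order_trans)

section \<open>The program\<close>

abbreviation seq (infixr ";;" 60) where "c ;; d \<equiv> Seq c d"

lemma runs_Seq_step:
  assumes "loop_free c" "bnd W s \<Longrightarrow> csafe W c s" "bnd W (step c s) \<Longrightarrow> runs W d t2 (step c s) Q"
    "ccost c + t2 \<le> t"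
  shows "runs W (c ;; d) t s Q"
  using assms by (intro runs_Seq[OF runs_step[where Q = "\<lambda>s'. s' = step c s"]]) auto

definition agree_except :: "nat set \<Rightarrow> nat set \<Rightarrow> state \<Rightarrow> state \<Rightarrow> bool" where
  "agree_except R A s s' \<longleftrightarrow> (\<forall>x. x \<notin> R \<longrightarrow> reg s' x = reg s x) \<and> (\<forall>k. k \<notin> A \<longrightarrow> arr s' k = arr s k)"

text \<open>Registers: 0 length of the string, 1 alphabet size, 2 and 11 loop counters, 3 start \<open>p\<close> and
  5 end \<open>q\<close> of the block, 4 split point \<open>r\<close>, 6 length of the buffer, 7 number of letters of the block,
  8 last used position, 9 exponent, 10 and 12 letters.  Arrays: 0 string, 1 output, 2 to 4
  occurrences, 5 skipped positions, 6 buffer, 7 table of lengths plus one (0 if there is no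
  solution), 8 table of strings in rows of length \<open>n + 1\<close>.\<close>

definition occ_body :: com where
  "occ_body =
    Assign 10 (Load 0 (Reg 2)) ;; Assign 2 (Plus (Reg 2) (Const 1)) ;;
    If (Equal (Load 2 (Reg 10)) (Const 0)) (Store 2 (Reg 10) (Reg 2))
      (If (Equal (Load 3 (Reg 10)) (Const 0)) (Store 3 (Reg 10) (Reg 2)) (Store 4 (Reg 10) (Reg 2)))"

definition occ_prog :: com where
  "occ_prog = While (Less (Reg 2) (Reg 0)) occ_body"

text \<open>The position is increased before it is used, because positions count from 1. A new
  letter is counted in register 7 when its second occurrence is met. The scan runs to the end of the
  string, past \<open>q\<close>.\<close>

definition build_body :: com where
  "build_body =
    Assign 10 (Load 0 (Reg 2)) ;; Assign 2 (Plus (Reg 2) (Const 1)) ;;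
    If (And (Less (Reg 3) (Load 3 (Reg 10))) (Not (Less (Reg 5) (Load 3 (Reg 10)))))
      (If (Equal (Load 3 (Reg 10)) (Reg 2)) (Assign 7 (Plus (Reg 7) (Const 1))) Skip ;;
       If (Equal (Load 5 (Reg 10)) (Reg 2)) Skip
         (Store 6 (Reg 6) (Reg 10) ;; Assign 6 (Plus (Reg 6) (Const 1)) ;; Assign 8 (Reg 2)))
      Skip"

definition build_prog :: com where
  "build_prog = (Assign 6 (Const 0) ;; Assign 7 (Const 0) ;; Assign 8 (Const 0) ;; Assign 2 (Reg 3)) ;;
     While (Less (Reg 2) (Reg 0)) build_body"

definition init_body :: com where
  "init_body =
    Assign 10 (Load 0 (Reg 2)) ;; Assign 2 (Plus (Reg 2) (Const 1)) ;;
    If (Equal (Reg 4) (Const 0)) (Store 5 (Reg 10) (Const 0))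
      (If (Less (Reg 4) (Load 3 (Reg 10))) (Store 5 (Reg 10) (Load 4 (Reg 10)))
         (Store 5 (Reg 10) (Load 2 (Reg 10))))"

definition init_prog :: com where
  "init_prog = (Assign 2 (Const 0) ;; Assign 9 (Const 2) ;;
      If (Equal (Reg 4) (Const 0)) (Assign 9 (Const 3)) Skip ;; Assign 5 (Plus (Reg 3) (Const 1))) ;;
     While (Less (Reg 2) (Reg 0)) init_body"

definition search_prog :: com where
  "search_prog = Assign 11 (Const 0) ;;
     While (And (Less (Plus (Reg 11) (Reg 7)) (Reg 6))
                (Equal (Load 6 (Reg 11)) (Load 6 (Plus (Reg 11) (Reg 7)))))
       (Assign 11 (Plus (Reg 11) (Const 1)))"

section \<open>The linear passes: occurrence tables, buffer, initial skips, search for a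
  mismatch\<close>

locale machine = thrice +
  fixes W :: nat
  assumes W: "4 * (length S + 2)\<^sup>2 \<le> W"
begin

abbreviation "n \<equiv> length S"

lemma W_linear: "16 * n + 16 \<le> W"
  using W by (simp add: power2_eq_square algebra_simps)

text \<open>These are addresses in the table of strings, with some slack. Its n+1 rows of n+1 cells
  are the reason why \<open>W\<close> has to be quadratic.\<close>

lemma W_index: "x \<le> n \<Longrightarrow> y \<le> 2 * n + 1 \<Longrightarrow> x * (n + 1) + y < W"
proof -
  assume "x \<le> n" "y \<le> 2 * n + 1"
  then have "x * (n + 1) + y \<le> n * (n + 1) + (2 * n + 1)" by (intro add_mono mult_le_mono1)
  also have "\<dots> < 4 * (n + 2)\<^sup>2" by (simp add: power2_eq_square algebra_simps)
  finally show ?thesis using W by simp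
qed

definition input_loaded :: "state \<Rightarrow> bool" where
  "input_loaded s \<longleftrightarrow> reg s 0 = n \<and> (\<forall>i<n. arr s 0 i = S ! i) \<and> arr s 2 = o1 \<and> arr s 3 = o2 \<and> arr s 4 = o3"

lemma occ_Suc:
  "occ k (Suc i) = (if length (positions_upto i (letter (Suc i))) = k then (occ k i)(letter (Suc i) := Suc i) else occ k i)"
  by (rule ext) (auto simp: occ_def positions_upto_Suc nth_append)

lemma occ_eq_0: "occ k i a = 0 \<longleftrightarrow> length (positions_upto i a) \<le> k"
proof -
  have "positions_upto i a ! k \<noteq> 0" if "k < length (positions_upto i a)"
    using nth_mem[OF that] by (auto simp: set_positions_upto)
  then show ?thesis by (auto simp: occ_def)
qed

lemma occ_runs:
  assumes "reg s 0 = n" "\<forall>i<n. arr s 0 i = S ! i" "reg s 2 = 0" "arr s 2 = (\<lambda>_. 0)"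
    "arr s 3 = (\<lambda>_. 0)" "arr s 4 = (\<lambda>_. 0)"
  shows "runs W occ_prog (100 * (n + 1)) s (\<lambda>s'. input_loaded s' \<and> agree_except {2, 10} {2, 3, 4} s s')"
  unfolding occ_prog_def
proof (rule runs_While[where t = 50 and \<mu> = "\<lambda>s'. n - reg s' 2" and
    I = "\<lambda>s'. reg s' 2 \<le> n \<and> arr s' 2 = occ 0 (reg s' 2) \<and> arr s' 3 = occ 1 (reg s' 2) \<and>
      arr s' 4 = occ 2 (reg s' 2) \<and> agree_except {2, 10} {2, 3, 4} s s'"])
  show "reg s 2 \<le> n \<and> arr s 2 = occ 0 (reg s 2) \<and> arr s 3 = occ 1 (reg s 2) \<and>
      arr s 4 = occ 2 (reg s 2) \<and> agree_except {2, 10} {2, 3, 4} s s"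
    using assms by (auto simp: agree_except_def occ_def fun_eq_iff)
next
  fix s' assume I: "reg s' 2 \<le> n \<and> arr s' 2 = occ 0 (reg s' 2) \<and> arr s' 3 = occ 1 (reg s' 2) \<and>
      arr s' 4 = occ 2 (reg s' 2) \<and> agree_except {2, 10} {2, 3, 4} s s'"
    and "bval (Less (Reg 2) (Reg 0)) s'"
  define i where "i = reg s' 2"
  have i: "i < n" "reg s' 0 = n" "arr s' 0 i = letter (Suc i)"
    using I \<open>bval _ _\<close> assms by (auto simp: agree_except_def i_def letter_def)
  \<comment> \<open>The letter just read has been seen at most twice before, so one of the three
    tables still has a free entry for it.\<close>
  have len: "length (positions_upto i (letter (Suc i))) \<le> 2"
    using length_posl_le[of "Suc i" "letter (Suc i)"] i by (simp add: positions_upto_Suc)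
  show "runs W occ_body 50 s' (\<lambda>s''. (reg s'' 2 \<le> n \<and> arr s'' 2 = occ 0 (reg s'' 2) \<and>
      arr s'' 3 = occ 1 (reg s'' 2) \<and> arr s'' 4 = occ 2 (reg s'' 2) \<and> agree_except {2, 10} {2, 3, 4} s s'') \<and>
      n - reg s'' 2 < n - reg s' 2)"
  proof (rule runs_step)
    show "csafe W occ_body s'" using i W_linear by (simp add: occ_body_def i_def[symmetric])
    have "length (positions_upto i (letter (Suc i))) = 0 \<or> length (positions_upto i (letter (Suc i))) = 1 \<or> length (positions_upto i (letter (Suc i))) = 2"
      using len by linarith
    then show "(reg (step occ_body s') 2 \<le> n \<and> arr (step occ_body s') 2 = occ 0 (reg (step occ_body s') 2) \<and>
      arr (step occ_body s') 3 = occ 1 (reg (step occ_body s') 2) \<and>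
      arr (step occ_body s') 4 = occ 2 (reg (step occ_body s') 2) \<and> agree_except {2, 10} {2, 3, 4} s (step occ_body s')) \<and>
      n - reg (step occ_body s') 2 < n - reg s' 2"
      using i I by (elim disjE) (simp_all add: occ_body_def i_def[symmetric] agree_except_def occ_Suc occ_eq_0)
  qed (simp_all add: occ_body_def)
qed (use assms in \<open>auto simp: agree_except_def input_loaded_def\<close>)

lemma upt_Suc_Suc: "p \<le> i \<Longrightarrow> [Suc p..<Suc (Suc i)] = [Suc p..<Suc i] @ [Suc i]"
  by simp

text \<open>Each letter is counted at its second occurrence, and \<open>o2\<close> is injective on
  \<open>new_letters p q\<close> because the letter can be read off the position.\<close>

lemma card_new_letters: "length (filter (\<lambda>i. letter i \<in> new_letters p q \<and> o2 (letter i) = i) [Suc p..<Suc n]) = card (new_letters p q)"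
proof -
  have "distinct (filter (\<lambda>i. letter i \<in> new_letters p q \<and> o2 (letter i) = i) [Suc p..<Suc n])" by simp
  then have "length (filter (\<lambda>i. letter i \<in> new_letters p q \<and> o2 (letter i) = i) [Suc p..<Suc n]) =
      card (set (filter (\<lambda>i. letter i \<in> new_letters p q \<and> o2 (letter i) = i) [Suc p..<Suc n]))"
    by (simp only: distinct_card)
  also have "set (filter (\<lambda>i. letter i \<in> new_letters p q \<and> o2 (letter i) = i) [Suc p..<Suc n]) = o2 ` new_letters p q"
  proof (intro equalityI subsetI)
    fix i assume "i \<in> o2 ` new_letters p q"
    then obtain a where a: "a \<in> new_letters p q" "i = o2 a" by auto
    then show "i \<in> set (filter (\<lambda>i. letter i \<in> new_letters p q \<and> o2 (letter i) = i) [Suc p..<Suc n])"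
      using new_letters_occ[OF a(1)] by (auto simp del: upt_Suc)
  qed (force simp del: upt_Suc)
  also have "inj_on o2 (new_letters p q)" by (rule inj_onI) (metis new_letters_occ(5))
  then have "card (o2 ` new_letters p q) = card (new_letters p q)" by (rule card_image)
  finally show ?thesis .
qed

text \<open>Register 8 is specified by an equivalence, which covers the empty word without a case
  distinction: the register is then 0.\<close>

lemma build_runs:
  assumes input_loaded: "input_loaded s" and p: "reg s 3 = p" "p \<le> n" and q: "reg s 5 = q" and sk: "arr s 5 = sk"
  shows "runs W build_prog (100 * (n + 1)) s (\<lambda>s'. agree_except {2, 6, 7, 8, 10} {6} s s' \<and>
    reg s' 6 = length (kept p q sk) \<and> map (arr s' 6) [0..<reg s' 6] = kept_word p q sk \<and>
    reg s' 7 = card (new_letters p q) \<and> (\<forall>e. reg s' 8 \<le> e \<longleftrightarrow> (\<forall>i \<in> set (kept p q sk). i \<le> e)))"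
proof -
  define Y where "Y = (\<lambda>i. filter (\<lambda>i. letter i \<in> new_letters p q \<and> sk (letter i) \<noteq> i) [Suc p..<Suc i])"
  define C where "C = (\<lambda>i. filter (\<lambda>i. letter i \<in> new_letters p q \<and> o2 (letter i) = i) [Suc p..<Suc i])"
  let ?I = "\<lambda>s'. p \<le> reg s' 2 \<and> reg s' 2 \<le> n \<and> reg s' 6 = length (Y (reg s' 2)) \<and>
    map (arr s' 6) [0..<reg s' 6] = map letter (Y (reg s' 2)) \<and> reg s' 7 = length (C (reg s' 2)) \<and>
    (\<forall>e. reg s' 8 \<le> e \<longleftrightarrow> (\<forall>i \<in> set (Y (reg s' 2)). i \<le> e)) \<and> agree_except {2, 6, 7, 8, 10} {6} s s'"
  have Y_Suc: "Y (Suc i) = Y i @ (if letter (Suc i) \<in> new_letters p q \<and> sk (letter (Suc i)) \<noteq> Suc i then [Suc i] else [])"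
    and C_Suc: "C (Suc i) = C i @ (if letter (Suc i) \<in> new_letters p q \<and> o2 (letter (Suc i)) = Suc i then [Suc i] else [])"
    if "p \<le> i" for i
    unfolding Y_def C_def upt_Suc_Suc[OF that] by simp_all
  have len: "length (Y i) \<le> i" "length (C i) \<le> i" for i
    using length_filter_le[of _ "[Suc p..<Suc i]"] unfolding Y_def C_def
    by (metis (no_types, lifting) diff_le_self le_trans length_upt diff_Suc_Suc)+
  have Yle: "k \<in> set (Y i) \<Longrightarrow> k \<le> i" for k i by (auto simp: Y_def simp del: upt_Suc)
  show ?thesis
    unfolding build_prog_def
  proof (rule runs_Seq_step)
    let ?c = "Assign 6 (Const 0) ;; Assign 7 (Const 0) ;; Assign 8 (Const 0) ;; Assign 2 (Reg 3)"
    show "csafe W ?c s" using W_linear by simp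
    show "runs W (While (Less (Reg 2) (Reg 0)) build_body) (80 * (n + 1)) (step ?c s)
      (\<lambda>s'. agree_except {2, 6, 7, 8, 10} {6} s s' \<and>
    reg s' 6 = length (kept p q sk) \<and> map (arr s' 6) [0..<reg s' 6] = kept_word p q sk \<and>
    reg s' 7 = card (new_letters p q) \<and> (\<forall>e. reg s' 8 \<le> e \<longleftrightarrow> (\<forall>i \<in> set (kept p q sk). i \<le> e)))"
    proof (rule runs_While[where t = 60 and \<mu> = "\<lambda>s'. n - reg s' 2" and I = ?I])
      show "?I (step ?c s)" using p input_loaded by (simp add: Y_def C_def agree_except_def del: upt_Suc)
    next
      fix s' assume I: "?I s'" and b: "bval (Less (Reg 2) (Reg 0)) s'"
      define i where "i = reg s' 2"
      define a where "a = letter (Suc i)"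
      have i: "i < n" "p \<le> i" "reg s' 0 = n" "reg s' 3 = p" "reg s' 5 = q" "arr s' 0 i = a" "arr s' 3 = o2"
        "arr s' 5 = sk"
        using I b input_loaded p q sk by (auto simp: agree_except_def i_def letter_def input_loaded_def a_def)
      have I': "reg s' 6 = length (Y i)" "map (arr s' 6) [0..<length (Y i)] = map letter (Y i)"
        "reg s' 7 = length (C i)" "\<And>e. reg s' 8 \<le> e \<longleftrightarrow> (\<forall>k \<in> set (Y i). k \<le> e)" "reg s' 2 = i"
        and sm: "agree_except {2, 6, 7, 8, 10} {6} s s'"
        using I by (auto simp: i_def)
      have aL: "a \<in> new_letters p q \<longleftrightarrow> p < o2 a \<and> \<not> q < o2 a" by (auto simp: new_letters_def)
      show "runs W build_body 60 s' (\<lambda>s''. ?I s'' \<and> n - reg s'' 2 < n - reg s' 2)"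
      proof (rule runs_step)
        show "csafe W build_body s'"
          using i W_linear I' len[of i] by (simp add: build_body_def)
        have Ye: "Suc i \<le> e \<Longrightarrow> k \<in> set (Y i) \<Longrightarrow> k \<le> e" for k e using Yle[of k i] by simp
        show "?I (step build_body s') \<and> n - reg (step build_body s') 2 < n - reg s' 2"
          using i I' sm Y_Suc[OF i(2)] C_Suc[OF i(2)]
          by (auto simp: build_body_def a_def[symmetric] aL agree_except_def intro: Ye)
      qed (simp_all add: build_body_def)
    next
      fix s' assume "?I s'" "\<not> bval (Less (Reg 2) (Reg 0)) s'"
      moreover from this have "reg s' 2 = n" using input_loaded by (simp add: agree_except_def input_loaded_def)
      moreover have Yn: "Y n = kept p q sk" "length (C n) = card (new_letters p q)"
        unfolding Y_def C_def kept_def by (rule refl card_new_letters)+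
      ultimately show "agree_except {2, 6, 7, 8, 10} {6} s s' \<and>
    reg s' 6 = length (kept p q sk) \<and> map (arr s' 6) [0..<reg s' 6] = kept_word p q sk \<and>
    reg s' 7 = card (new_letters p q) \<and> (\<forall>e. reg s' 8 \<le> e \<longleftrightarrow> (\<forall>i \<in> set (kept p q sk). i \<le> e))"
        using Yn by auto
    qed (use input_loaded in \<open>auto simp: agree_except_def input_loaded_def\<close>)
  qed simp_all
qed


lemma init_runs:
  assumes input_loaded: "input_loaded s" and p: "reg s 3 = p" "p \<le> n" and r: "reg s 4 = r"
  shows "runs W init_prog (100 * (n + 1)) s (\<lambda>s'. agree_except {2, 5, 9, 10} {5} s s' \<and>
    reg s' 5 = Suc p \<and> reg s' 9 = (if r = 0 then 3 else 2) \<and> (\<forall>a \<in> set S. arr s' 5 a = skip0 r a))"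
  unfolding init_prog_def
proof (rule runs_Seq_step)
  let ?c = "Assign 2 (Const 0) ;; Assign 9 (Const 2) ;;
      If (Equal (Reg 4) (Const 0)) (Assign 9 (Const 3)) Skip ;; Assign 5 (Plus (Reg 3) (Const 1))"
  let ?I = "\<lambda>s'. reg s' 2 \<le> n \<and> (\<forall>a \<in> set (take (reg s' 2) S). arr s' 5 a = skip0 r a) \<and>
    reg s' 5 = Suc p \<and> reg s' 9 = (if r = 0 then 3 else 2) \<and> agree_except {2, 5, 9, 10} {5} s s'"
  show "csafe W ?c s" using W_linear p by simp
  show "runs W (While (Less (Reg 2) (Reg 0)) init_body) (50 * (n + 1)) (step ?c s)
    (\<lambda>s'. agree_except {2, 5, 9, 10} {5} s s' \<and> reg s' 5 = Suc p \<and> reg s' 9 = (if r = 0 then 3 else 2) \<and>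
      (\<forall>a \<in> set S. arr s' 5 a = skip0 r a))"
  proof (rule runs_While[where t = 40 and \<mu> = "\<lambda>s'. n - reg s' 2" and I = ?I])
    show "?I (step ?c s)" using p r by (simp add: agree_except_def)
  next
    fix s' assume I: "?I s'" and b: "bval (Less (Reg 2) (Reg 0)) s'"
    define i where "i = reg s' 2"
    define a where "a = S ! i"
    have i: "i < n" "reg s' 0 = n" "reg s' 4 = r" "arr s' 0 i = a" "arr s' 2 = o1" "arr s' 3 = o2"
      "arr s' 4 = o3" "reg s' 2 = i"
      using I b input_loaded r by (auto simp: agree_except_def i_def input_loaded_def a_def)
    have tk: "take (Suc i) S = take i S @ [a]" using i by (simp add: a_def take_Suc_conv_app_nth)
    show "runs W init_body 40 s' (\<lambda>s''. ?I s'' \<and> n - reg s'' 2 < n - reg s' 2)"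
    proof (rule runs_step)
      show "csafe W init_body s'" using i W_linear by (simp add: init_body_def)
      show "?I (step init_body s') \<and> n - reg (step init_body s') 2 < n - reg s' 2"
        using i I tk by (auto simp: init_body_def agree_except_def skip0_def)
    qed (simp_all add: init_body_def)
  next
    fix s' assume I: "?I s'" and b: "\<not> bval (Less (Reg 2) (Reg 0)) s'"
    then have "reg s' 2 = n" using input_loaded by (simp add: agree_except_def input_loaded_def)
    then show "agree_except {2, 5, 9, 10} {5} s s' \<and> reg s' 5 = Suc p \<and> reg s' 9 = (if r = 0 then 3 else 2) \<and>
      (\<forall>a \<in> set S. arr s' 5 a = skip0 r a)" using I by simp
  qed (use input_loaded in \<open>auto simp: agree_except_def input_loaded_def\<close>)
qed simp_all

lemma search_runs:
  assumes l: "reg s 6 \<le> n" and c: "reg s 7 \<le> n" and y: "map (arr s 6) [0..<reg s 6] = y" and c': "reg s 7 = c"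
  shows "runs W search_prog (100 * (n + 1)) s (\<lambda>s'. agree_except {11} {} s s' \<and> reg s' 11 \<le> n \<and>
    (if reg s' 11 + c < length y then first_mismatch c y (reg s' 11)
     else \<forall>j. j + c < length y \<longrightarrow> y ! j = y ! (j + c)))"
  unfolding search_prog_def
proof (rule runs_Seq_step)
  let ?b = "And (Less (Plus (Reg 11) (Reg 7)) (Reg 6))
                (Equal (Load 6 (Reg 11)) (Load 6 (Plus (Reg 11) (Reg 7))))"
  let ?I = "\<lambda>s'. reg s' 11 \<le> n \<and> (\<forall>j < reg s' 11. y ! j = y ! (j + c)) \<and> agree_except {11} {} s s'"
  have y': "length y = reg s 6" "j < reg s 6 \<Longrightarrow> y ! j = arr s 6 j" for j using y by auto
  show "runs W (While ?b (Assign 11 (Plus (Reg 11) (Const 1)))) (50 * (n + 1)) (step (Assign 11 (Const 0)) s)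
    (\<lambda>s'. agree_except {11} {} s s' \<and> reg s' 11 \<le> n \<and>
    (if reg s' 11 + c < length y then first_mismatch c y (reg s' 11)
     else \<forall>j. j + c < length y \<longrightarrow> y ! j = y ! (j + c)))"
  proof (rule runs_While[where t = 10 and \<mu> = "\<lambda>s'. n - reg s' 11" and I = ?I])
    show "?I (step (Assign 11 (Const 0)) s)" by (simp add: agree_except_def)
  next
    fix s' assume I: "?I s'"
    then show "bsafe W ?b s'" using c l W_linear by (simp add: agree_except_def)
    assume b: "bval ?b s'"
    show "runs W (Assign 11 (Plus (Reg 11) (Const 1))) 10 s' (\<lambda>s''. ?I s'' \<and> n - reg s'' 11 < n - reg s' 11)"
    proof (rule runs_step)
      show "csafe W (Assign 11 (Plus (Reg 11) (Const 1))) s'"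
        using I c l W_linear by (simp add: agree_except_def)
      have "reg s' 11 + c < length y" "y ! reg s' 11 = y ! (reg s' 11 + c)"
        using b I y' c' by (simp_all add: agree_except_def)
      then show "?I (step (Assign 11 (Plus (Reg 11) (Const 1))) s') \<and>
          n - reg (step (Assign 11 (Plus (Reg 11) (Const 1))) s') 11 < n - reg s' 11"
        using I c l y' by (auto simp: agree_except_def less_Suc_eq)
    qed simp_all
  next
    fix s' assume I: "?I s'" and b: "\<not> bval ?b s'"
    show "agree_except {11} {} s s' \<and> reg s' 11 \<le> n \<and> (if reg s' 11 + c < length y then first_mismatch c y (reg s' 11)
     else \<forall>j. j + c < length y \<longrightarrow> y ! j = y ! (j + c))"
    proof (cases "reg s' 11 + c < length y")
      case True
      then show ?thesis using b I y' c' by (auto simp: agree_except_def first_mismatch_def)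
    next
      case False
      have "y ! j = y ! (j + c)" if "j + c < length y" for j using I False that by simp
      then show ?thesis using I False by simp
    qed
  qed simp_all
qed (use W_linear in simp_all)

end

section \<open>Extending a string of the table by the buffer\<close>

definition copy_prefix_prog :: com where
  "copy_prefix_prog =
    (Assign 11 (Const 0) ;; Assign 13 (Times (Reg 3) (Plus (Reg 0) (Const 1))) ;;
     Assign 14 (Times (Reg 5) (Plus (Reg 0) (Const 1)))) ;;
    While (Less (Plus (Reg 11) (Const 1)) (Load 7 (Reg 3)))
      (Store 8 (Plus (Reg 14) (Reg 11)) (Load 8 (Plus (Reg 13) (Reg 11))) ;;
       Assign 11 (Plus (Reg 11) (Const 1)))"

definition copy_buffer_prog :: com where
  "copy_buffer_prog = (Assign 2 (Const 0) ;; Assign 14 (Plus (Reg 14) (Reg 11))) ;;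
    While (Less (Reg 2) (Reg 6))
      (Store 8 (Plus (Reg 14) (Reg 2)) (Load 6 (Reg 2)) ;; Assign 2 (Plus (Reg 2) (Const 1)))"

definition copy_prog :: com where
  "copy_prog = copy_prefix_prog ;; copy_buffer_prog ;; Store 7 (Reg 5) (Plus (Load 7 (Reg 3)) (Reg 6))"

context machine
begin

definition row_start :: "nat \<Rightarrow> nat" where "row_start q = q * (n + 1)"

definition table_string :: "state \<Rightarrow> nat \<Rightarrow> nat list" where
  "table_string s q = map (\<lambda>i. arr s 8 (row_start q + i)) [0..<arr s 7 q - 1]"

lemma row_start_less: "p < q \<Longrightarrow> row_start p + n < row_start q"
  using mult_le_mono1[of "Suc p" q "n + 1"] by (simp add: row_start_def)

lemma row_start_W: "q \<le> n \<Longrightarrow> i \<le> 2 * n + 1 \<Longrightarrow> row_start q + i < W"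
  unfolding row_start_def by (rule W_index)

lemma copy_prefix_runs:
  assumes input_loaded: "input_loaded s" and p: "reg s 3 = p" "p < q" and q: "reg s 5 = q" "q \<le> n"
    and w: "arr s 7 p = Suc w" "w \<le> n"
  shows "runs W copy_prefix_prog (100 * (n + 1)) s (\<lambda>s'. agree_except {11, 13, 14} {8} s s' \<and>
    reg s' 11 = w \<and> reg s' 14 = row_start q \<and>
    arr s' 8 = (\<lambda>k. if row_start q \<le> k \<and> k < row_start q + w then arr s 8 (row_start p + (k - row_start q)) else arr s 8 k))"
  unfolding copy_prefix_prog_def
proof (rule runs_Seq_step)
  let ?c = "Assign 11 (Const 0) ;; Assign 13 (Times (Reg 3) (Plus (Reg 0) (Const 1))) ;;
     Assign 14 (Times (Reg 5) (Plus (Reg 0) (Const 1)))"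
  let ?d = "Store 8 (Plus (Reg 14) (Reg 11)) (Load 8 (Plus (Reg 13) (Reg 11))) ;;
       Assign 11 (Plus (Reg 11) (Const 1))"
  let ?b = "Less (Plus (Reg 11) (Const 1)) (Load 7 (Reg 3))"
  let ?I = "\<lambda>s'. reg s' 11 \<le> w \<and> reg s' 13 = row_start p \<and> reg s' 14 = row_start q \<and> agree_except {11, 13, 14} {8} s s' \<and>
    arr s' 8 = (\<lambda>k. if row_start q \<le> k \<and> k < row_start q + reg s' 11 then arr s 8 (row_start p + (k - row_start q)) else arr s 8 k)"
  have n: "reg s 0 = n" using input_loaded by (simp add: input_loaded_def)
  show "csafe W ?c s"
    using W_linear row_start_W[of p 0] row_start_W[of q 0] p q n by (simp add: row_start_def)
  show "runs W (While ?b ?d) (50 * (n + 1)) (step ?c s) (\<lambda>s'. agree_except {11, 13, 14} {8} s s' \<and>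
    reg s' 11 = w \<and> reg s' 14 = row_start q \<and>
    arr s' 8 = (\<lambda>k. if row_start q \<le> k \<and> k < row_start q + w then arr s 8 (row_start p + (k - row_start q)) else arr s 8 k))"
  proof (rule runs_While[where t = 30 and \<mu> = "\<lambda>s'. w - reg s' 11" and I = ?I])
    show "?I (step ?c s)" using n p q by (auto simp: agree_except_def row_start_def)
  next
    fix s' assume I: "?I s'"
    then show "bsafe W ?b s'" using w W_linear by (simp add: agree_except_def)
    assume b: "bval ?b s'"
    define j where "j = reg s' 11"
    have j: "j < w" using b I w p by (simp add: agree_except_def j_def)
    \<comment> \<open>As \<open>p < q\<close>, the cells that are read lie below the row that is
      being written.\<close>
    have pj: "row_start p + j < row_start q" using row_start_less[OF p(2)] j w by linarith
    have v: "arr s' 8 (row_start p + j) = arr s 8 (row_start p + j)" using I pj by (simp add: j_def)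
    show "runs W ?d 30 s' (\<lambda>s''. ?I s'' \<and> w - reg s'' 11 < w - reg s' 11)"
    proof (rule runs_step)
      show "csafe W ?d s'"
        using I j w W_linear row_start_W[of p j] row_start_W[of q j] p q by (simp add: j_def[symmetric])
      show "?I (step ?d s') \<and> w - reg (step ?d s') 11 < w - reg s' 11"
        using I j v by (auto simp: j_def[symmetric] agree_except_def fun_eq_iff)
    qed simp_all
  next
    fix s' assume I: "?I s'" and b: "\<not> bval ?b s'"
    then have "reg s' 11 = w" using w p by (simp add: agree_except_def)
    then show "agree_except {11, 13, 14} {8} s s' \<and> reg s' 11 = w \<and> reg s' 14 = row_start q \<and>
    arr s' 8 = (\<lambda>k. if row_start q \<le> k \<and> k < row_start q + w then arr s 8 (row_start p + (k - row_start q)) else arr s 8 k)"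
      using I by simp
  qed (use w in \<open>simp add: agree_except_def\<close>)
qed simp_all

lemma copy_buffer_runs:
  assumes b: "reg s 14 = row_start q" "q \<le> n" and w: "reg s 11 = w" and l: "reg s 6 = l" "w + l \<le> n"
  shows "runs W copy_buffer_prog (100 * (n + 1)) s (\<lambda>s'. agree_except {2, 14} {8} s s' \<and>
    arr s' 8 = (\<lambda>k. if row_start q + w \<le> k \<and> k < row_start q + w + l then arr s 6 (k - (row_start q + w)) else arr s 8 k))"
  unfolding copy_buffer_prog_def
proof (rule runs_Seq_step)
  let ?c = "Assign 2 (Const 0) ;; Assign 14 (Plus (Reg 14) (Reg 11))"
  let ?d = "Store 8 (Plus (Reg 14) (Reg 2)) (Load 6 (Reg 2)) ;; Assign 2 (Plus (Reg 2) (Const 1))"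
  let ?b = "Less (Reg 2) (Reg 6)"
  let ?I = "\<lambda>s'. reg s' 2 \<le> l \<and> reg s' 14 = row_start q + w \<and> agree_except {2, 14} {8} s s' \<and>
    arr s' 8 = (\<lambda>k. if row_start q + w \<le> k \<and> k < row_start q + w + reg s' 2 then arr s 6 (k - (row_start q + w)) else arr s 8 k)"
  show "csafe W ?c s" using W_linear row_start_W[of q w] b w l by simp
  show "runs W (While ?b ?d) (50 * (n + 1)) (step ?c s) (\<lambda>s'. agree_except {2, 14} {8} s s' \<and>
    arr s' 8 = (\<lambda>k. if row_start q + w \<le> k \<and> k < row_start q + w + l then arr s 6 (k - (row_start q + w)) else arr s 8 k))"
  proof (rule runs_While[where t = 30 and \<mu> = "\<lambda>s'. l - reg s' 2" and I = ?I])
    show "?I (step ?c s)" using b w by (auto simp: agree_except_def)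
  next
    fix s' assume I: "?I s'" and b': "bval ?b s'"
    define j where "j = reg s' 2"
    have j: "j < l" using b' I l by (simp add: agree_except_def j_def)
    show "runs W ?d 30 s' (\<lambda>s''. ?I s'' \<and> l - reg s'' 2 < l - reg s' 2)"
    proof (rule runs_step)
      show "csafe W ?d s'"
        using I j l W_linear row_start_W[of q "w + j"] b by (simp add: j_def[symmetric] add.assoc)
      show "?I (step ?d s') \<and> l - reg (step ?d s') 2 < l - reg s' 2"
        using I j by (auto simp: j_def[symmetric] agree_except_def fun_eq_iff)
    qed simp_all
  next
    fix s' assume I: "?I s'" and b': "\<not> bval ?b s'"
    then have "reg s' 2 = l" using l by (simp add: agree_except_def)
    then show "agree_except {2, 14} {8} s s' \<and>
    arr s' 8 = (\<lambda>k. if row_start q + w \<le> k \<and> k < row_start q + w + l then arr s 6 (k - (row_start q + w)) else arr s 8 k)"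
      using I by simp
  qed (use l in \<open>simp_all add: agree_except_def\<close>)
qed simp_all

lemma copy_runs:
  assumes input_loaded: "input_loaded s" and p: "reg s 3 = p" "p < q" and q: "reg s 5 = q" "q \<le> n"
    and w: "arr s 7 p = Suc w" and l: "reg s 6 = l" "w + l \<le> n"
  shows "runs W copy_prog (250 * (n + 1)) s (\<lambda>s'. agree_except {2, 11, 13, 14} {7, 8} s s' \<and>
    arr s' 7 = (arr s 7)(q := Suc (w + l)) \<and>
    table_string s' q = table_string s p @ map (arr s 6) [0..<l] \<and>
    (\<forall>q' \<le> n. q' \<noteq> q \<longrightarrow> arr s 7 q' \<le> Suc n \<longrightarrow> table_string s' q' = table_string s q'))"
  unfolding copy_prog_def
proof (rule runs_Seq[where u = "100 * (n + 1)" and v = "150 * (n + 1)"])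
  show "runs W copy_prefix_prog (100 * (n + 1)) s (\<lambda>s'. agree_except {11, 13, 14} {8} s s' \<and>
    reg s' 11 = w \<and> reg s' 14 = row_start q \<and>
    arr s' 8 = (\<lambda>k. if row_start q \<le> k \<and> k < row_start q + w then arr s 8 (row_start p + (k - row_start q)) else arr s 8 k))"
    using assms by (intro copy_prefix_runs) auto
next
  fix s1 assume s1: "agree_except {11, 13, 14} {8} s s1 \<and> reg s1 11 = w \<and> reg s1 14 = row_start q \<and>
    arr s1 8 = (\<lambda>k. if row_start q \<le> k \<and> k < row_start q + w then arr s 8 (row_start p + (k - row_start q)) else arr s 8 k)"
  show "runs W (copy_buffer_prog ;; Store 7 (Reg 5) (Plus (Load 7 (Reg 3)) (Reg 6))) (150 * (n + 1)) s1
    (\<lambda>s'. agree_except {2, 11, 13, 14} {7, 8} s s' \<and> arr s' 7 = (arr s 7)(q := Suc (w + l)) \<and>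
    table_string s' q = table_string s p @ map (arr s 6) [0..<l] \<and>
    (\<forall>q' \<le> n. q' \<noteq> q \<longrightarrow> arr s 7 q' \<le> Suc n \<longrightarrow> table_string s' q' = table_string s q'))"
  proof (rule runs_Seq[where u = "100 * (n + 1)" and v = "50"])
    show "runs W copy_buffer_prog (100 * (n + 1)) s1 (\<lambda>s'. agree_except {2, 14} {8} s1 s' \<and>
      arr s' 8 = (\<lambda>k. if row_start q + w \<le> k \<and> k < row_start q + w + l then arr s1 6 (k - (row_start q + w)) else arr s1 8 k))"
      using s1 q l by (intro copy_buffer_runs) (auto simp: agree_except_def)
  next
    fix s2 assume s2: "agree_except {2, 14} {8} s1 s2 \<and>
      arr s2 8 = (\<lambda>k. if row_start q + w \<le> k \<and> k < row_start q + w + l then arr s1 6 (k - (row_start q + w)) else arr s1 8 k)"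
    have sm: "agree_except {2, 11, 13, 14} {8} s s2" using s1 s2 by (auto simp: agree_except_def)
    have T: "arr s2 8 k = (if row_start q \<le> k \<and> k < row_start q + w then arr s 8 (row_start p + (k - row_start q))
        else if row_start q + w \<le> k \<and> k < row_start q + w + l then arr s 6 (k - (row_start q + w)) else arr s 8 k)" for k
      using s1 s2 by (auto simp: agree_except_def)
    show "runs W (Store 7 (Reg 5) (Plus (Load 7 (Reg 3)) (Reg 6))) 50 s2
      (\<lambda>s'. agree_except {2, 11, 13, 14} {7, 8} s s' \<and> arr s' 7 = (arr s 7)(q := Suc (w + l)) \<and>
      table_string s' q = table_string s p @ map (arr s 6) [0..<l] \<and>
      (\<forall>q' \<le> n. q' \<noteq> q \<longrightarrow> arr s 7 q' \<le> Suc n \<longrightarrow> table_string s' q' = table_string s q'))"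
    proof (rule runs_step)
      let ?s = "step (Store 7 (Reg 5) (Plus (Load 7 (Reg 3)) (Reg 6))) s2"
      show "csafe W (Store 7 (Reg 5) (Plus (Load 7 (Reg 3)) (Reg 6))) s2"
        using sm p q w l W_linear by (simp add: agree_except_def)
      have s7: "arr ?s 7 = (arr s 7)(q := Suc (w + l))" and s8: "arr ?s 8 = arr s2 8"
        and sm': "agree_except {2, 11, 13, 14} {7, 8} s ?s"
        using sm p q w l by (simp_all add: agree_except_def)
      have "table_string ?s q = table_string s p @ map (arr s 6) [0..<l]"
        unfolding table_string_def s7 s8 T using w
        by (intro nth_equalityI) (auto simp: nth_append)
      moreover have "table_string ?s q' = table_string s q'" if q': "q' \<le> n" "q' \<noteq> q" "arr s 7 q' \<le> Suc n" for q'
      proof -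
        have "arr s2 8 (row_start q' + i) = arr s 8 (row_start q' + i)" if i: "i < arr s 7 q' - 1" for i
        proof -
          \<comment> \<open>Strings have length at most n and rows have n+1 cells, so the cells
            written for \<open>q\<close> belong to no string of another row.\<close>
          have "row_start q' + i < row_start q \<or> row_start q + w + l \<le> row_start q' + i"
            using row_start_less[of q q'] row_start_less[of q' q] i q' l by (cases "q < q'") auto
          then show ?thesis by (auto simp: T)
        qed
        then show ?thesis unfolding table_string_def s7 s8 using q' by (intro map_cong) auto
      qed
      ultimately show "agree_except {2, 11, 13, 14} {7, 8} s ?s \<and> arr ?s 7 = (arr s 7)(q := Suc (w + l)) \<and>
        table_string ?s q = table_string s p @ map (arr s 6) [0..<l] \<and>
        (\<forall>q' \<le> n. q' \<noteq> q \<longrightarrow> arr s 7 q' \<le> Suc n \<longrightarrow> table_string ?s q' = table_string s q')"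
        using s7 sm' by blast
    qed simp_all
  qed simp
qed simp


section \<open>The table invariant and one round of the search\<close>

definition sound :: "state \<Rightarrow> bool" where
  "sound s \<longleftrightarrow> (\<forall>q \<le> n. arr s 7 q \<noteq> 0 \<longrightarrow> prefix_solution q (table_string s q))"

text \<open>The transitive relation satisfied by all code run for the start \<open>p\<close>.
  Entries only grow, so what was found stays found; entries up to \<open>p\<close> are frozen, so
  the solution being extended is the same throughout.\<close>

definition improve :: "nat \<Rightarrow> state \<Rightarrow> state \<Rightarrow> bool" where
  "improve p s s' \<longleftrightarrow> sound s' \<and> (\<forall>q. arr s 7 q \<le> arr s' 7 q) \<and> (\<forall>q \<le> p. arr s' 7 q = arr s 7 q) \<and>
     agree_except {2, 4, 5, 6, 7, 8, 9, 10, 11, 12, 13, 14} {5, 6, 7, 8} s s'"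

lemma improve_trans: "improve p s s' \<Longrightarrow> improve p s' s'' \<Longrightarrow> improve p s s''"
  by (auto simp: improve_def agree_except_def intro: order_trans)

lemma improve_agree_except:
  "sound s \<Longrightarrow> agree_except {2, 4, 5, 6, 7, 8, 9, 10, 11, 12, 13, 14} {5, 6} s s' \<Longrightarrow> improve p s s'"
  by (auto simp: improve_def agree_except_def sound_def table_string_def)

lemma input_loaded_agree_except: "input_loaded s \<Longrightarrow> agree_except R A s s' \<Longrightarrow> 0 \<notin> R \<Longrightarrow> A \<inter> {0, 2, 3, 4} = {} \<Longrightarrow> input_loaded s'"
  by (auto simp: input_loaded_def agree_except_def)

lemma improve_input_loaded: "input_loaded s \<Longrightarrow> improve p s s' \<Longrightarrow> input_loaded s'"
  unfolding improve_def by (auto elim!: input_loaded_agree_except)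

lemma sound_bound: "sound s \<Longrightarrow> q \<le> n \<Longrightarrow> arr s 7 q \<le> Suc n"
  using prefix_solution_length[of q "table_string s q"] by (fastforce simp: sound_def table_string_def)

end

text \<open>The mismatching letter is taken from the second copy. If it is already widened, nothing
  can be repaired, and \<open>q\<close> is set to n+1, which ends the loop over
  \<open>q\<close>.\<close>

definition widen_prog :: com where
  "widen_prog = Assign 12 (Load 6 (Plus (Reg 11) (Reg 7))) ;;
     If (Equal (Load 5 (Reg 12)) (Load 3 (Reg 12))) (Assign 5 (Plus (Reg 0) (Const 1)))
       (Store 5 (Reg 12) (Load 3 (Reg 12)))"

definition update_prog :: com where
  "update_prog = If (And (Not (Less (Reg 5) (Reg 8))) (Less (Load 7 (Reg 5)) (Plus (Load 7 (Reg 3)) (Reg 6))))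
       copy_prog Skip ;; Assign 5 (Plus (Reg 5) (Const 1))"

text \<open>A round that widens a letter keeps \<open>q\<close>, so the changed skips are tested
  again for the same end.\<close>

definition inner_prog :: com where
  "inner_prog = build_prog ;;
     If (Equal (Reg 6) (Times (Reg 9) (Reg 7)))
       (search_prog ;; If (Less (Plus (Reg 11) (Reg 7)) (Reg 6)) widen_prog update_prog)
       (Assign 5 (Plus (Reg 0) (Const 1)))"

context machine
begin

lemma length_kept: "length (kept p q sk) \<le> n"
  unfolding kept_def by (rule order_trans[OF length_filter_le]) (simp del: upt_Suc)

lemma update_runs:
  assumes input_loaded: "input_loaded s" and sound: "sound s" and p: "reg s 3 = p" "p < q" "arr s 7 p \<noteq> 0"
    and q: "reg s 5 = q" "q \<le> n" and d: "d \<in> {2, 3}"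
    and l: "reg s 6 = length (kept p q sk)" "length (kept p q sk) = d * card (new_letters p q)"
    and y: "map (arr s 6) [0..<reg s 6] = kept_word p q sk"
    and per: "\<And>j. j + card (new_letters p q) < length (kept p q sk) \<Longrightarrow> kept_word p q sk ! j = kept_word p q sk ! (j + card (new_letters p q))"
    and last: "\<And>e. reg s 8 \<le> e \<longleftrightarrow> (\<forall>i \<in> set (kept p q sk). i \<le> e)"
  shows "runs W update_prog (300 * (n + 1)) s (\<lambda>s'. improve p s s' \<and> reg s' 4 = reg s 4 \<and> reg s' 9 = reg s 9 \<and>
    reg s' 5 = Suc q \<and> arr s' 5 = arr s 5 \<and>
    ((\<forall>i \<in> set (kept p q sk). i \<le> q) \<longrightarrow> arr s 7 p + d * card (new_letters p q) \<le> arr s' 7 q))"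
  unfolding update_prog_def
proof (rule runs_Seq[where u = "270 * (n + 1)" and v = 20])
  let ?b = "And (Not (Less (Reg 5) (Reg 8))) (Less (Load 7 (Reg 5)) (Plus (Load 7 (Reg 3)) (Reg 6)))"
  let ?Q = "\<lambda>s'. improve p s s' \<and> reg s' 4 = reg s 4 \<and> reg s' 9 = reg s 9 \<and>
    reg s' 5 = q \<and> arr s' 5 = arr s 5 \<and>
    ((\<forall>i \<in> set (kept p q sk). i \<le> q) \<longrightarrow> arr s 7 p + d * card (new_letters p q) \<le> arr s' 7 q)"
  have Vp: "arr s 7 p \<le> Suc n" using sound_bound[OF sound, of p] p q by simp
  have ln: "length (kept p q sk) \<le> n"
    by (rule length_kept)
  show "runs W (If ?b copy_prog Skip) (270 * (n + 1)) s ?Q"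
  proof (rule runs_If)
    show "bsafe W ?b s" using Vp ln l p q W_linear by simp
    show "runs W copy_prog (250 * (n + 1)) s ?Q" if b: "bval ?b s"
    proof -
      have lq: "\<forall>i \<in> set (kept p q sk). i \<le> q" using b last[of q] q by simp
      obtain x where x: "is_block p q d x" "kept_word p q sk = concat (replicate d x)"
        using check_sound[of p q d sk] p q d l per lq by auto
      obtain w where w: "arr s 7 p = Suc w" using p(3) not0_implies_Suc by blast
      have gp: "prefix_solution p (table_string s p)" using sound p q by (simp add: sound_def)
      have g: "prefix_solution q (table_string s p @ kept_word p q sk)"
        unfolding x(2) by (rule prefix_solution_step[OF gp p(2) q(2) d x(1)])
      \<comment> \<open>That the string fits into its row follows from its correctness: it is a
        subsequence of the string of length n.\<close>
      have wl: "w + length (kept p q sk) \<le> n" using prefix_solution_length[OF g] by (simp add: table_string_def w)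
      show ?thesis
      proof (rule runs_mono[OF copy_runs[OF input_loaded p(1,2) q w l(1) wl] order_refl])
        fix s' assume s': "agree_except {2, 11, 13, 14} {7, 8} s s' \<and>
          arr s' 7 = (arr s 7)(q := Suc (w + length (kept p q sk))) \<and>
          table_string s' q = table_string s p @ map (arr s 6) [0..<length (kept p q sk)] \<and>
          (\<forall>q' \<le> n. q' \<noteq> q \<longrightarrow> arr s 7 q' \<le> Suc n \<longrightarrow> table_string s' q' = table_string s q')"
        have "prefix_solution q' (table_string s' q')" if "q' \<le> n" "arr s' 7 q' \<noteq> 0" for q'
        proof (cases "q' = q")
          case True
          then show ?thesis using s' g y l(1) by simp
        next
          case False
          then show ?thesis using s' that sound sound_bound[OF sound, of q'] by (simp add: sound_def)
        qed
        then have "sound s'" by (simp add: sound_def)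
        moreover have "arr s 7 q < Suc (w + length (kept p q sk))" using b p q l w by simp
        ultimately show "?Q s'"
          using s' p q w l by (auto simp: improve_def agree_except_def)
      qed
    qed
    show "runs W Skip (250 * (n + 1)) s ?Q" if b: "\<not> bval ?b s"
    proof (rule runs_step)
      have "improve p s s" using sound by (simp add: improve_def agree_except_def)
      then show "?Q (step Skip s)" using b last[of q] p q l by auto
    qed simp_all
  qed simp
next
  fix s1 assume s1: "improve p s s1 \<and> reg s1 4 = reg s 4 \<and> reg s1 9 = reg s 9 \<and>
    reg s1 5 = q \<and> arr s1 5 = arr s 5 \<and>
    ((\<forall>i \<in> set (kept p q sk). i \<le> q) \<longrightarrow> arr s 7 p + d * card (new_letters p q) \<le> arr s1 7 q)"
  let ?c = "Assign 5 (Plus (Reg 5) (Const 1))"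
  show "runs W ?c 20 s1 (\<lambda>s'. improve p s s' \<and> reg s' 4 = reg s 4 \<and> reg s' 9 = reg s 9 \<and>
    reg s' 5 = Suc q \<and> arr s' 5 = arr s 5 \<and>
    ((\<forall>i \<in> set (kept p q sk). i \<le> q) \<longrightarrow> arr s 7 p + d * card (new_letters p q) \<le> arr s' 7 q))"
  proof (rule runs_step)
    show "csafe W ?c s1" using s1 q W_linear by simp
    have "improve p s1 (step ?c s1)"
      using s1 by (intro improve_agree_except) (auto simp: improve_def agree_except_def)
    then have "improve p s (step ?c s1)" using s1 improve_trans by blast
    then show "improve p s (step ?c s1) \<and> reg (step ?c s1) 4 = reg s 4 \<and> reg (step ?c s1) 9 = reg s 9 \<and>
    reg (step ?c s1) 5 = Suc q \<and> arr (step ?c s1) 5 = arr s 5 \<and>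
    ((\<forall>i \<in> set (kept p q sk). i \<le> q) \<longrightarrow> arr s 7 p + d * card (new_letters p q) \<le> arr (step ?c s1) 7 q)"
      using s1 by simp
  qed simp_all
qed simp

text \<open>The alternatives are: a wrong length, which ends the search; a mismatch, which ends it
  or widens one letter; and a passed test, which moves on to the next end. \<open>v\<close> and
  \<open>v'\<close> stand for the table entry at \<open>p\<close> and for the new one at
  \<open>q\<close>.\<close>

definition outcome :: "nat \<Rightarrow> nat \<Rightarrow> nat \<Rightarrow> (nat \<Rightarrow> nat) \<Rightarrow> nat \<Rightarrow> nat \<Rightarrow> (nat \<Rightarrow> nat) \<Rightarrow> nat \<Rightarrow> bool" where
  "outcome p q d sk v q' sk' v' \<longleftrightarrow>
     (let y = kept_word p q sk; c = card (new_letters p q) in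
      length y \<noteq> d * c \<and> q' = Suc n \<and> sk' = sk \<or>
      (\<exists>j a. length y = d * c \<and> first_mismatch c y j \<and> a = y ! (j + c) \<and> a \<in> set y \<and>
         (sk a = o2 a \<and> q' = Suc n \<and> sk' = sk \<or> sk a \<noteq> o2 a \<and> q' = q \<and> sk' = sk(a := o2 a))) \<or>
      length y = d * c \<and> q' = Suc q \<and> sk' = sk \<and> ((\<forall>i \<in> set (kept p q sk). i \<le> q) \<longrightarrow> v + d * c \<le> v'))"

lemma inner_runs:
  assumes input_loaded: "input_loaded s" and sound: "sound s" and p: "reg s 3 = p" "p < q" "arr s 7 p \<noteq> 0"
    and q: "reg s 5 = q" "q \<le> n" and d: "reg s 9 = d" "d \<in> {2, 3}"
  shows "runs W inner_prog (600 * (n + 1)) s (\<lambda>s'. improve p s s' \<and> reg s' 4 = reg s 4 \<and> reg s' 9 = d \<and>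
    outcome p q d (arr s 5) (arr s 7 p) (reg s' 5) (arr s' 5) (arr s' 7 q))"
    (is "runs _ _ _ _ ?Q")
  unfolding inner_prog_def
proof (rule runs_Seq[where u = "100 * (n + 1)" and v = "500 * (n + 1)"])
  let ?sk = "arr s 5"
  let ?y = "kept_word p q ?sk" and ?c = "card (new_letters p q)"
  show "runs W build_prog (100 * (n + 1)) s (\<lambda>s'. agree_except {2, 6, 7, 8, 10} {6} s s' \<and>
    reg s' 6 = length (kept p q ?sk) \<and> map (arr s' 6) [0..<reg s' 6] = ?y \<and>
    reg s' 7 = ?c \<and> (\<forall>e. reg s' 8 \<le> e \<longleftrightarrow> (\<forall>i \<in> set (kept p q ?sk). i \<le> e)))"
    using assms by (intro build_runs) auto
  fix s1 assume s1: "agree_except {2, 6, 7, 8, 10} {6} s s1 \<and>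
    reg s1 6 = length (kept p q ?sk) \<and> map (arr s1 6) [0..<reg s1 6] = ?y \<and>
    reg s1 7 = ?c \<and> (\<forall>e. reg s1 8 \<le> e \<longleftrightarrow> (\<forall>i \<in> set (kept p q ?sk). i \<le> e))"
  have inp1: "input_loaded s1" using s1 input_loaded by (auto elim!: input_loaded_agree_except)
  have imp1: "improve p s s1" using sound s1 by (intro improve_agree_except) (auto simp: agree_except_def)
  have ln: "length (kept p q ?sk) \<le> n"
    by (rule length_kept)
  have cn: "?c \<le> n"
    using card_mono[OF _ new_letters_subset_set, of p q] card_length[of S] by simp
  let ?A = "Assign 5 (Plus (Reg 0) (Const 1))"
  show "runs W (If (Equal (Reg 6) (Times (Reg 9) (Reg 7)))
       (search_prog ;; If (Less (Plus (Reg 11) (Reg 7)) (Reg 6)) widen_prog update_prog) ?A)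
       (500 * (n + 1)) s1 ?Q"
  proof (rule runs_If[where u = "450 * (n + 1)"])
    show "bsafe W (Equal (Reg 6) (Times (Reg 9) (Reg 7))) s1"
      using s1 d cn W_linear by (auto simp: agree_except_def)
    show "runs W ?A (450 * (n + 1)) s1 ?Q" if "\<not> bval (Equal (Reg 6) (Times (Reg 9) (Reg 7))) s1"
    proof (rule runs_step)
      show "csafe W ?A s1" using inp1 W_linear by (simp add: input_loaded_def)
      have "improve p s1 (step ?A s1)"
        using imp1 by (intro improve_agree_except) (auto simp: improve_def agree_except_def)
      then have "improve p s (step ?A s1)" using imp1 improve_trans by blast
      then show "?Q (step ?A s1)"
        using that s1 d inp1 by (simp add: agree_except_def outcome_def input_loaded_def)
    qed simp_all
    assume "bval (Equal (Reg 6) (Times (Reg 9) (Reg 7))) s1"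
    then have ldc: "length (kept p q ?sk) = d * ?c" using s1 d by (simp add: agree_except_def)
    show "runs W (search_prog ;; If (Less (Plus (Reg 11) (Reg 7)) (Reg 6)) widen_prog update_prog)
       (450 * (n + 1)) s1 ?Q"
    proof (rule runs_Seq[where u = "100 * (n + 1)" and v = "350 * (n + 1)"])
      show "runs W search_prog (100 * (n + 1)) s1 (\<lambda>s'. agree_except {11} {} s1 s' \<and> reg s' 11 \<le> n \<and>
        (if reg s' 11 + ?c < length ?y then first_mismatch ?c ?y (reg s' 11)
         else \<forall>j. j + ?c < length ?y \<longrightarrow> ?y ! j = ?y ! (j + ?c)))"
        using s1 ln cn by (intro search_runs) auto
      fix s2 assume s2: "agree_except {11} {} s1 s2 \<and> reg s2 11 \<le> n \<and>
        (if reg s2 11 + ?c < length ?y then first_mismatch ?c ?y (reg s2 11)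
         else \<forall>j. j + ?c < length ?y \<longrightarrow> ?y ! j = ?y ! (j + ?c))"
      have sm2: "agree_except {2, 6, 7, 8, 10, 11} {6} s s2" using s1 s2 by (auto simp: agree_except_def)
      have inp2: "input_loaded s2" using sm2 input_loaded by (auto elim!: input_loaded_agree_except)
      have imp2: "improve p s s2" using sound sm2 by (intro improve_agree_except) (auto simp: agree_except_def)
      have s2': "reg s2 6 = length (kept p q ?sk)" "map (arr s2 6) [0..<reg s2 6] = ?y" "reg s2 7 = ?c"
        "\<And>e. reg s2 8 \<le> e \<longleftrightarrow> (\<forall>i \<in> set (kept p q ?sk). i \<le> e)"
        using s1 s2 by (auto simp: agree_except_def)
      show "runs W (If (Less (Plus (Reg 11) (Reg 7)) (Reg 6)) widen_prog update_prog) (350 * (n + 1)) s2 ?Q"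
      proof (rule runs_If[where u = "300 * (n + 1)"])
        show "bsafe W (Less (Plus (Reg 11) (Reg 7)) (Reg 6)) s2"
          using s2 s2'(3) cn W_linear by simp
        show "runs W widen_prog (300 * (n + 1)) s2 ?Q"
          if "bval (Less (Plus (Reg 11) (Reg 7)) (Reg 6)) s2"
        proof (rule runs_step)
          define j where "j = reg s2 11"
          define a where "a = ?y ! (j + ?c)"
          have True: "j + ?c < length ?y" using that s2' by (simp add: j_def)
          have fm: "first_mismatch ?c ?y j" using True s2 by (simp add: j_def)
          have "arr s2 6 (j + ?c) = map (arr s2 6) [0..<reg s2 6] ! (j + ?c)"
            using True s2'(1) by simp
          then have a: "arr s2 6 (j + ?c) = a" using s2'(2) by (simp add: a_def)
          have aset: "a \<in> set ?y" unfolding a_def using True by (rule nth_mem)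
          have r: "reg s2 11 = j" "reg s2 7 = ?c" "arr s2 5 = ?sk" "arr s2 3 = o2" "reg s2 0 = n" "reg s2 5 = q"
            using s2' sm2 inp2 q by (simp_all add: j_def agree_except_def input_loaded_def)
          show "csafe W widen_prog s2"
            using True ln W_linear r by (simp add: widen_prog_def)
          have "improve p s2 (step widen_prog s2)"
            using imp2 by (intro improve_agree_except) (auto simp: improve_def agree_except_def widen_prog_def)
          then have "improve p s (step widen_prog s2)" using imp2 improve_trans by blast
          moreover have "outcome p q d ?sk (arr s 7 p) (reg (step widen_prog s2) 5)
              (arr (step widen_prog s2) 5) (arr (step widen_prog s2) 7 q)"
            unfolding outcome_def Let_def
            using ldc fm aset a r
            by (intro disjI2 disjI1 exI[of _ j] exI[of _ a]) (simp add: widen_prog_def a_def)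
          moreover have "reg (step widen_prog s2) 4 = reg s 4" "reg (step widen_prog s2) 9 = d"
            using sm2 d by (auto simp: widen_prog_def agree_except_def)
          ultimately show "?Q (step widen_prog s2)" by blast
        qed (simp_all add: widen_prog_def)
        show "runs W update_prog (300 * (n + 1)) s2 ?Q"
          if b: "\<not> bval (Less (Plus (Reg 11) (Reg 7)) (Reg 6)) s2"
        proof (rule runs_mono[OF update_runs[where p = p and q = q and d = d and sk = ?sk] order_refl])
          show "input_loaded s2" by (rule inp2)
          show "sound s2" using imp2 by (simp add: improve_def)
          show "?y ! j = ?y ! (j + ?c)" if "j + ?c < length (kept p q ?sk)" for j
            using that s2 b s2' by simp
          show "reg s2 8 \<le> e \<longleftrightarrow> (\<forall>i \<in> set (kept p q ?sk). i \<le> e)" for e by (rule s2'(4))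
          fix s' assume "improve p s2 s' \<and> reg s' 4 = reg s2 4 \<and> reg s' 9 = reg s2 9 \<and> reg s' 5 = Suc q \<and>
            arr s' 5 = arr s2 5 \<and>
            ((\<forall>i \<in> set (kept p q ?sk). i \<le> q) \<longrightarrow> arr s2 7 p + d * ?c \<le> arr s' 7 q)"
          moreover have "reg s2 4 = reg s 4" "reg s2 9 = d" "arr s2 5 = ?sk" "arr s2 7 = arr s 7"
            using sm2 d by (simp_all add: agree_except_def)
          ultimately show "?Q s'" using imp2 improve_trans ldc by (auto simp: outcome_def Let_def)
        qed (use sm2 p q d s2' ldc in \<open>auto simp: agree_except_def\<close>)
      qed simp
    qed simp
  qed simp
qed simp

end

section \<open>The loops over ends, split points and starts, and the answer\<close>

definition end_loop :: com where
  "end_loop = While (Not (Less (Reg 0) (Reg 5))) inner_prog"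

definition mode_loop :: com where
  "mode_loop = Assign 4 (Const 0) ;;
     While (Not (Less (Reg 0) (Reg 4))) (init_prog ;; end_loop ;; Assign 4 (Plus (Reg 4) (Const 1)))"

definition start_loop :: com where
  "start_loop = Assign 3 (Const 0) ;;
     While (Less (Reg 3) (Reg 0))
       (If (Equal (Load 7 (Reg 3)) (Const 0)) Skip mode_loop ;; Assign 3 (Plus (Reg 3) (Const 1)))"

text \<open>Register 0 is overwritten last: until then it holds the length that addresses the last
  row, afterwards it signals that a solution exists.\<close>

definition output_prog :: com where
  "output_prog =
    (Assign 11 (Const 0) ;; Assign 14 (Times (Reg 0) (Plus (Reg 0) (Const 1))) ;;
     Assign 1 (Minus (Load 7 (Reg 0)) (Const 1)) ;; Assign 0 (Const 1)) ;;
    While (Less (Reg 11) (Reg 1))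
      (Store 1 (Reg 11) (Load 8 (Plus (Reg 14) (Reg 11))) ;; Assign 11 (Plus (Reg 11) (Const 1)))"

text \<open>With boundaries 0 and n, \<open>build_prog\<close> counts the letters that occur at
  least twice; comparing this count with the alphabet size tests whether all letters can
  appear.\<close>

definition final_prog :: com where
  "final_prog = (Assign 3 (Const 0) ;; Assign 5 (Reg 0)) ;; build_prog ;;
     If (And (Equal (Reg 7) (Reg 1)) (And (Less (Const 0) (Reg 1)) (Less (Const 0) (Load 7 (Reg 0)))))
       output_prog (Assign 0 (Const 0))"

definition lsrs_prog :: com where
  "lsrs_prog = occ_prog ;; Store 7 (Const 0) (Const 1) ;; start_loop ;; final_prog"

context machine
begin

text \<open>Invariant: every target is already recorded, or it lies ahead and some \<open>J\<close>
  with \<open>admissible p d e J\<close> holds of the current skips. In the second case giving up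
  would contradict admissibility. The measure adds the ends still to come and the letters whose skip
  is not yet \<open>o2\<close>.\<close>

lemma end_loop_runs:
  assumes input_loaded: "input_loaded s" and sound: "sound s" and p: "reg s 3 = p" "p < n" "arr s 7 p \<noteq> 0"
    and q: "reg s 5 = Suc p" and d: "reg s 9 = d" "d \<in> {2, 3}" and sk: "\<forall>a \<in> set S. arr s 5 a = sk0 a"
  shows "runs W end_loop (1300 * (n + 1)\<^sup>2) s (\<lambda>s'. improve p s s' \<and> reg s' 4 = reg s 4 \<and>
    (\<forall>e. p < e \<longrightarrow> e \<le> n \<longrightarrow> target p d sk0 e \<longrightarrow> arr s 7 p + d * card (new_letters p e) \<le> arr s' 7 e))"
proof -
  let ?v = "arr s 7 p"
  let ?I = "\<lambda>s'. improve p s s' \<and> reg s' 4 = reg s 4 \<and> reg s' 9 = d \<and> p < reg s' 5 \<and> reg s' 5 \<le> Suc n \<and>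
    (\<forall>e. p < e \<longrightarrow> e \<le> n \<longrightarrow> target p d sk0 e \<longrightarrow> ?v + d * card (new_letters p e) \<le> arr s' 7 e \<or>
      (reg s' 5 \<le> e \<and> (\<exists>J. J (arr s' 5) \<and> admissible p d e J)))"
  let ?M = "\<lambda>s'. Suc n - reg s' 5 + card {a \<in> set S. arr s' 5 a \<noteq> o2 a}"
  show ?thesis
    unfolding end_loop_def
  proof (rule runs_While[where t = "600 * (n + 1)" and \<mu> = ?M and I = ?I])
  have "improve p s s" using sound by (simp add: improve_def agree_except_def)
  moreover have "\<exists>J. J (arr s 5) \<and> admissible p d e J" if "target p d sk0 e" for e
    using that sk unfolding target_def by blast
  ultimately show "?I s" using p q d by (auto simp: Suc_le_eq)
next
  fix s1 assume I: "?I s1"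
  show "bsafe W (Not (Less (Reg 0) (Reg 5))) s1" by simp
  define q1 where "q1 = reg s1 5"
  define k1 where "k1 = arr s1 5"
  have inp1: "input_loaded s1" and sound1: "sound s1" and p1: "reg s1 3 = p" and v1: "arr s1 7 p = ?v"
    using I improve_input_loaded[OF input_loaded] p by (auto simp: improve_def agree_except_def)
  assume b: "bval (Not (Less (Reg 0) (Reg 5))) s1"
  have q1: "p < q1" "q1 \<le> n" using I b inp1 by (auto simp: q1_def input_loaded_def)
  show "runs W inner_prog (600 * (n + 1)) s1 (\<lambda>s'. ?I s' \<and> ?M s' < ?M s1)"
  proof (rule runs_mono[OF inner_runs[OF inp1 sound1 p1 q1(1) _ q1_def[symmetric] q1(2) _ d(2)] order_refl])
    show "arr s1 7 p \<noteq> 0" using v1 p by simp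
    show "reg s1 9 = d" using I by simp
    fix s2 assume s2: "improve p s1 s2 \<and> reg s2 4 = reg s1 4 \<and> reg s2 9 = d \<and>
      outcome p q1 d (arr s1 5) (arr s1 7 p) (reg s2 5) (arr s2 5) (arr s2 7 q1)"
    have occ: "outcome p q1 d k1 ?v (reg s2 5) (arr s2 5) (arr s2 7 q1)"
      using s2 by (simp add: k1_def v1)
    have imp: "improve p s s2" using I s2 improve_trans by blast
    have bounds: "p < reg s2 5 \<and> reg s2 5 \<le> Suc n" using occ q1 unfolding outcome_def Let_def by auto
    have tgt: "?v + d * card (new_letters p e) \<le> arr s2 7 e \<or>
        (reg s2 5 \<le> e \<and> (\<exists>J. J (arr s2 5) \<and> admissible p d e J))"
      if e: "p < e" "e \<le> n" "target p d sk0 e" for e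
    proof (cases "?v + d * card (new_letters p e) \<le> arr s1 7 e")
      case True
      also have "arr s1 7 e \<le> arr s2 7 e" using s2 by (simp add: improve_def)
      finally show ?thesis by simp
    next
      case False
      then obtain J where qe: "q1 \<le> e" and J: "J k1" and adm: "admissible p d e J"
        using I e by (auto simp: q1_def k1_def)
      have adm1: "length (kept p q1 k1) = d * card (new_letters p q1)"
        "\<And>j v. first_mismatch (card (new_letters p q1)) (kept_word p q1 k1) j \<Longrightarrow> v = kept_word p q1 k1 ! (j + card (new_letters p q1)) \<Longrightarrow>
          k1 v \<noteq> o2 v \<and> J (k1(v := o2 v))"
        "q1 = e \<Longrightarrow> \<forall>i \<in> set (kept p q1 k1). i \<le> q1"
        using adm q1(1) qe J unfolding admissible_def by blast+
      from occ consider
          (bad) "length (kept_word p q1 k1) \<noteq> d * card (new_letters p q1)"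
        | (widen) j a where "first_mismatch (card (new_letters p q1)) (kept_word p q1 k1) j"
            "a = kept_word p q1 k1 ! (j + card (new_letters p q1))"
            "k1 a = o2 a \<or> k1 a \<noteq> o2 a \<and> reg s2 5 = q1 \<and> arr s2 5 = k1(a := o2 a)"
        | (ok) "reg s2 5 = Suc q1" "arr s2 5 = k1"
            "(\<forall>i \<in> set (kept p q1 k1). i \<le> q1) \<longrightarrow> ?v + d * card (new_letters p q1) \<le> arr s2 7 q1"
        unfolding outcome_def Let_def by blast
      then show ?thesis
      proof cases
        case bad
        then show ?thesis using adm1(1) by simp
      next
        case widen
        from adm1(2)[OF widen(1,2)] widen(3) have "reg s2 5 = q1" "J (arr s2 5)" by auto
        then show ?thesis using qe adm by blast
      next
        case ok
        show ?thesis
        proof (cases "q1 = e")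
          case True
          then show ?thesis using adm1(3) ok(3) by blast
        next
          case False
          then have "reg s2 5 \<le> e" using ok(1) qe by simp
          then show ?thesis using ok(2) J adm by blast
        qed
      qed
    qed
    have "?M s2 < ?M s1"
    proof -
      have le: "Suc n - q1 > 0" using q1 by simp
      from occ consider "reg s2 5 = Suc n" "arr s2 5 = k1"
        | a where "a \<in> set (kept_word p q1 k1)" "k1 a \<noteq> o2 a" "reg s2 5 = q1" "arr s2 5 = k1(a := o2 a)"
        | "reg s2 5 = Suc q1" "arr s2 5 = k1"
        unfolding outcome_def Let_def by blast
      then show ?thesis
      proof cases
        case (2 a)
        have "a \<in> set S" using 2(1) new_letters_subset_set[of p q1] by (auto simp: kept_def)
        then have "{b \<in> set S. arr s2 5 b \<noteq> o2 b} \<subset> {b \<in> set S. k1 b \<noteq> o2 b}"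
          using 2(2,4) by auto
        then have "card {b \<in> set S. arr s2 5 b \<noteq> o2 b} < card {b \<in> set S. k1 b \<noteq> o2 b}"
          by (intro psubset_card_mono) auto
        then show ?thesis using 2(3) by (simp add: q1_def k1_def)
      qed (use le in \<open>auto simp: q1_def k1_def\<close>)
    qed
    then show "?I s2 \<and> ?M s2 < ?M s1" using imp bounds tgt I s2 by simp
  qed
next
  have "card {a \<in> set S. arr s 5 a \<noteq> o2 a} \<le> n"
    using card_mono[of "set S" "{a \<in> set S. arr s 5 a \<noteq> o2 a}"] card_length[of S] by fastforce
  \<comment> \<open>At most n advances of \<open>q\<close>, at most n widenings, and the final
    test.\<close>
  then have "Suc n - reg s 5 + card {a \<in> set S. arr s 5 a \<noteq> o2 a} + 1 \<le> 2 * (n + 1)" using q by simp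
  then have "(Suc n - reg s 5 + card {a \<in> set S. arr s 5 a \<noteq> o2 a} + 1) * (5 + 600 * (n + 1)) \<le>
      2 * (n + 1) * (605 * (n + 1))" by (intro mult_le_mono) auto
  also have "\<dots> \<le> 1300 * (n + 1)\<^sup>2" by (simp add: power2_eq_square algebra_simps)
  also have "5 + 600 * (n + 1) = 1 + bcost (Not (Less (Reg 0) (Reg 5))) + 600 * (n + 1)" by simp
  finally show "(Suc n - reg s 5 + card {a \<in> set S. arr s 5 a \<noteq> o2 a} + 1) *
      (1 + bcost (Not (Less (Reg 0) (Reg 5))) + 600 * (n + 1)) \<le> 1300 * (n + 1)\<^sup>2" .
next
  fix s' assume I: "improve p s s' \<and> reg s' 4 = reg s 4 \<and> reg s' 9 = d \<and> p < reg s' 5 \<and> reg s' 5 \<le> Suc n \<and>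
    (\<forall>e. p < e \<longrightarrow> e \<le> n \<longrightarrow> target p d sk0 e \<longrightarrow> arr s 7 p + d * card (new_letters p e) \<le> arr s' 7 e \<or>
      (reg s' 5 \<le> e \<and> (\<exists>J. J (arr s' 5) \<and> admissible p d e J)))"
    and b: "\<not> bval (Not (Less (Reg 0) (Reg 5))) s'"
  have "reg s' 0 = n" using improve_input_loaded[OF input_loaded] I by (auto simp: input_loaded_def)
  then have "n < reg s' 5" using b by simp
  then show "improve p s s' \<and> reg s' 4 = reg s 4 \<and>
    (\<forall>e. p < e \<longrightarrow> e \<le> n \<longrightarrow> target p d sk0 e \<longrightarrow> arr s 7 p + d * card (new_letters p e) \<le> arr s' 7 e)"
    using I by (meson le_less_trans not_less)
qed
qed

lemma mode_loop_runs:
  assumes input_loaded: "input_loaded s" and sound: "sound s" and p: "reg s 3 = p" "p < n" "arr s 7 p \<noteq> 0"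
  shows "runs W mode_loop (4000 * (n + 1) ^ 3) s (\<lambda>s'. improve p s s' \<and>
    (\<forall>e d x. p < e \<longrightarrow> e \<le> n \<longrightarrow> d \<in> {2, 3} \<longrightarrow> is_block p e d x \<longrightarrow> arr s 7 p + d * card (new_letters p e) \<le> arr s' 7 e))"
  unfolding mode_loop_def
proof (rule runs_Seq_step)
  let ?v = "arr s 7 p"
  let ?mode = "\<lambda>r. if r = 0 then 3 else 2 :: nat"
  let ?I = "\<lambda>s'. improve p s s' \<and> reg s' 4 \<le> Suc n \<and> (\<forall>r e. r < reg s' 4 \<longrightarrow> p < e \<longrightarrow> e \<le> n \<longrightarrow>
    target p (?mode r) (skip0 r) e \<longrightarrow> ?v + ?mode r * card (new_letters p e) \<le> arr s' 7 e)"
  let ?d = "init_prog ;; end_loop ;; Assign 4 (Plus (Reg 4) (Const 1))"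
  let ?b = "Not (Less (Reg 0) (Reg 4))"
  let ?Q = "\<lambda>s'. improve p s s' \<and>
    (\<forall>e d x. p < e \<longrightarrow> e \<le> n \<longrightarrow> d \<in> {2, 3} \<longrightarrow> is_block p e d x \<longrightarrow> ?v + d * card (new_letters p e) \<le> arr s' 7 e)"
  show "runs W (While ?b ?d) (3500 * (n + 1) ^ 3) (step (Assign 4 (Const 0)) s) ?Q"
  proof (rule runs_While[where t = "1500 * (n + 1)\<^sup>2" and \<mu> = "\<lambda>s'. Suc n - reg s' 4" and I = ?I])
    have "improve p s (step (Assign 4 (Const 0)) s)"
      using sound by (intro improve_agree_except) (auto simp: agree_except_def)
    then show "?I (step (Assign 4 (Const 0)) s)" by simp
  next
    fix s1 assume I: "?I s1" and b: "bval ?b s1"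
    define r where "r = reg s1 4"
    have imp1: "improve p s s1" using I by simp
    have inp1: "input_loaded s1" and sound1: "sound s1" and p1: "reg s1 3 = p" and v1: "arr s1 7 p = ?v"
      using I improve_input_loaded[OF input_loaded] p by (auto simp: improve_def agree_except_def)
    have r: "r \<le> n" using b inp1 by (simp add: r_def input_loaded_def)
    show "runs W ?d (1500 * (n + 1)\<^sup>2) s1 (\<lambda>s'. ?I s' \<and> Suc n - reg s' 4 < Suc n - reg s1 4)"
    proof (rule runs_Seq)
      show "runs W init_prog (100 * (n + 1)) s1 (\<lambda>s'. agree_except {2, 5, 9, 10} {5} s1 s' \<and>
        reg s' 5 = Suc p \<and> reg s' 9 = ?mode r \<and> (\<forall>a \<in> set S. arr s' 5 a = skip0 r a))"
        using inp1 p1 p by (intro init_runs) (auto simp: r_def)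
      fix s2 assume s2: "agree_except {2, 5, 9, 10} {5} s1 s2 \<and>
        reg s2 5 = Suc p \<and> reg s2 9 = ?mode r \<and> (\<forall>a \<in> set S. arr s2 5 a = skip0 r a)"
      have imp12: "improve p s1 s2" using s2 sound1 by (intro improve_agree_except) (auto simp: agree_except_def)
      then have imp2: "improve p s s2" using imp1 improve_trans by blast
      have inp2: "input_loaded s2" using s2 inp1 by (auto elim!: input_loaded_agree_except)
      have v2: "arr s2 7 p = ?v" and p2: "reg s2 3 = p" and r2: "reg s2 4 = r"
        using s2 v1 p1 by (auto simp: agree_except_def r_def)
      show "runs W (end_loop ;; Assign 4 (Plus (Reg 4) (Const 1))) (1300 * (n + 1)\<^sup>2 + 10) s2
        (\<lambda>s'. ?I s' \<and> Suc n - reg s' 4 < Suc n - reg s1 4)"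
      proof (rule runs_Seq)
        show "runs W end_loop (1300 * (n + 1)\<^sup>2) s2 (\<lambda>s'. improve p s2 s' \<and> reg s' 4 = reg s2 4 \<and>
          (\<forall>e. p < e \<longrightarrow> e \<le> n \<longrightarrow> target p (?mode r) (skip0 r) e \<longrightarrow>
            arr s2 7 p + ?mode r * card (new_letters p e) \<le> arr s' 7 e))"
          using inp2 imp2 p2 p v2 s2 by (intro end_loop_runs) (auto simp: improve_def)
        fix s3 assume s3: "improve p s2 s3 \<and> reg s3 4 = reg s2 4 \<and>
          (\<forall>e. p < e \<longrightarrow> e \<le> n \<longrightarrow> target p (?mode r) (skip0 r) e \<longrightarrow>
            arr s2 7 p + ?mode r * card (new_letters p e) \<le> arr s3 7 e)"
        let ?c = "Assign 4 (Plus (Reg 4) (Const 1))"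
        show "runs W ?c 10 s3 (\<lambda>s'. ?I s' \<and> Suc n - reg s' 4 < Suc n - reg s1 4)"
        proof (rule runs_step)
          show "csafe W ?c s3" using s3 r2 r W_linear by simp
          have imp3: "improve p s s3" and imp13: "improve p s1 s3"
            using s3 imp2 imp12 improve_trans by blast+
          have "improve p s3 (step ?c s3)"
            using imp3 by (intro improve_agree_except) (auto simp: agree_except_def improve_def)
          then have imp4: "improve p s (step ?c s3)" using imp3 improve_trans by blast
          have "?v + ?mode r' * card (new_letters p e) \<le> arr s3 7 e"
            if "r' < Suc r" "p < e" "e \<le> n" "target p (?mode r') (skip0 r') e" for r' e
          proof (cases "r' = r")
            case True
            then show ?thesis using that s3 v2 by simp
          next
            case False
            then have "r' < reg s1 4" using that(1) by (simp add: r_def)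
            then have "?v + ?mode r' * card (new_letters p e) \<le> arr s1 7 e" using I that(2-) by blast
            also have "\<dots> \<le> arr s3 7 e" using imp13 by (simp add: improve_def)
            finally show ?thesis .
          qed
          then show "?I (step ?c s3) \<and> Suc n - reg (step ?c s3) 4 < Suc n - reg s1 4"
            using imp4 s3 r2 r by (auto simp: r_def)
        qed simp_all
      qed simp
    qed (simp add: power2_eq_square algebra_simps)
  next
    have "(n + 2) * (5 + 1500 * (n + 1)\<^sup>2) \<le> (2 * (n + 1)) * (1505 * (n + 1)\<^sup>2)"
      by (intro mult_le_mono) auto
    also have "2 * N * (1505 * N\<^sup>2) = 3010 * N ^ 3" for N :: nat
      by (simp add: power2_eq_square power3_eq_cube)
    also have "3010 * (n + 1) ^ 3 \<le> 3500 * (n + 1) ^ 3" by simp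
    also have "n + 2 = Suc n - reg (step (Assign 4 (Const 0)) s) 4 + 1" by simp
    also have "5 + 1500 * (n + 1)\<^sup>2 = 1 + bcost ?b + 1500 * (n + 1)\<^sup>2" by simp
    finally show "(Suc n - reg (step (Assign 4 (Const 0)) s) 4 + 1) * (1 + bcost ?b + 1500 * (n + 1)\<^sup>2)
        \<le> 3500 * (n + 1) ^ 3" .
  next
    fix s' assume I: "?I s'" and b: "\<not> bval ?b s'"
    have "reg s' 0 = n" using improve_input_loaded[OF input_loaded] I by (auto simp: input_loaded_def)
    then have r: "reg s' 4 = Suc n" using b I by auto
    have "?v + d * card (new_letters p e) \<le> arr s' 7 e"
      if e: "p < e" "e \<le> n" "d \<in> {2, 3}" "is_block p e d x" for e d x
    proof (cases "d = 3")
      case True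
      then have "target p (?mode 0) (skip0 0) e" using cube_target e by simp
      then show ?thesis using I r e True by fastforce
    next
      case False
      then have d: "d = 2" using e by simp
      then obtain r' where r': "r' \<in> {1..n}" "target p 2 (skip0 r') e" using square_target e by blast
      then have "target p (?mode r') (skip0 r') e" by auto
      moreover have "r' < reg s' 4" using r r' by simp
      ultimately have "?v + ?mode r' * card (new_letters p e) \<le> arr s' 7 e" using I e by blast
      then show ?thesis using d r' by auto
    qed
    then show "?Q s'" using I by blast
  qed simp_all
qed (use W_linear in simp_all)


text \<open>When the loop reaches \<open>p\<close>, the entry at \<open>p\<close> is final, since
  starts from \<open>p\<close> on change larger entries only. Hence all blocks leaving a processed
  start are accounted for with its final value, and optimality follows by induction over
  \<open>prefix_solution\<close>.\<close>

lemma start_loop_runs: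
  assumes input_loaded: "input_loaded s" and V: "arr s 7 = (\<lambda>_. 0)(0 := 1)"
  shows "runs W start_loop (5000 * (n + 1) ^ 4) s (\<lambda>s'. input_loaded s' \<and> sound s' \<and> reg s' 1 = reg s 1 \<and>
    (\<forall>q w. prefix_solution q w \<longrightarrow> Suc (length w) \<le> arr s' 7 q))"
  unfolding start_loop_def
proof (rule runs_Seq_step)
  let ?b = "Less (Reg 3) (Reg 0)"
  let ?m = "If (Equal (Load 7 (Reg 3)) (Const 0)) Skip mode_loop"
  let ?d = "?m ;; Assign 3 (Plus (Reg 3) (Const 1))"
  let ?done = "\<lambda>s' p'. arr s' 7 p' \<noteq> 0 \<longrightarrow> (\<forall>e d x. p' < e \<longrightarrow> e \<le> n \<longrightarrow> d \<in> {2, 3} \<longrightarrow>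
      is_block p' e d x \<longrightarrow> arr s' 7 p' + d * card (new_letters p' e) \<le> arr s' 7 e)"
  let ?I = "\<lambda>s'. input_loaded s' \<and> sound s' \<and> reg s' 1 = reg s 1 \<and> reg s' 3 \<le> n \<and> 1 \<le> arr s' 7 0 \<and>
    (\<forall>p' < reg s' 3. ?done s' p')"
  let ?Q = "\<lambda>s'. input_loaded s' \<and> sound s' \<and> reg s' 1 = reg s 1 \<and>
    (\<forall>q w. prefix_solution q w \<longrightarrow> Suc (length w) \<le> arr s' 7 q)"
  show "runs W (While ?b ?d) (4900 * (n + 1) ^ 4) (step (Assign 3 (Const 0)) s) ?Q"
  proof (rule runs_While[where t = "4100 * (n + 1) ^ 3" and \<mu> = "\<lambda>s'. n - reg s' 3" and I = ?I])
    have "sound (step (Assign 3 (Const 0)) s)"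
      using V prefix_solution_0 by (simp add: sound_def table_string_def)
    then show "?I (step (Assign 3 (Const 0)) s)" using input_loaded V by (simp add: input_loaded_def)
  next
    fix s1 assume I: "?I s1" and b: "bval ?b s1"
    define p where "p = reg s1 3"
    have p: "p < n" using b I by (simp add: p_def input_loaded_def)
    show "runs W ?d (4100 * (n + 1) ^ 3) s1 (\<lambda>s'. ?I s' \<and> n - reg s' 3 < n - reg s1 3)"
    proof (rule runs_Seq)
      show "runs W ?m (4050 * (n + 1) ^ 3) s1 (\<lambda>s'. improve p s1 s' \<and> ?done s' p)"
      proof (rule runs_If)
        show "bsafe W (Equal (Load 7 (Reg 3)) (Const 0)) s1" using W_linear by simp
        show "runs W Skip (4000 * (n + 1) ^ 3) s1 (\<lambda>s'. improve p s1 s' \<and> ?done s' p)"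
          if "bval (Equal (Load 7 (Reg 3)) (Const 0)) s1"
          by (rule runs_step) (use that I in \<open>simp_all add: improve_def agree_except_def p_def\<close>)
        show "runs W mode_loop (4000 * (n + 1) ^ 3) s1 (\<lambda>s'. improve p s1 s' \<and> ?done s' p)"
          if "\<not> bval (Equal (Load 7 (Reg 3)) (Const 0)) s1"
        proof (rule runs_mono[OF mode_loop_runs[where p = p] order_refl])
          fix s' assume "improve p s1 s' \<and> (\<forall>e d x. p < e \<longrightarrow> e \<le> n \<longrightarrow> d \<in> {2, 3} \<longrightarrow> is_block p e d x \<longrightarrow>
            arr s1 7 p + d * card (new_letters p e) \<le> arr s' 7 e)"
          moreover from this have "arr s' 7 p = arr s1 7 p" by (simp add: improve_def)
          ultimately show "improve p s1 s' \<and> ?done s' p" by metis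
        qed (use I p that in \<open>simp_all add: p_def\<close>)
        show "1 + bcost (Equal (Load 7 (Reg 3)) (Const 0)) + 4000 * (n + 1) ^ 3 \<le> 4050 * (n + 1) ^ 3"
          using one_le_power[of "n + 1" 3] by simp
      qed
      fix s2 assume s2: "improve p s1 s2 \<and> ?done s2 p"
      let ?c = "Assign 3 (Plus (Reg 3) (Const 1))"
      have r3: "reg s2 3 = p" "reg s2 1 = reg s 1"
        using s2 I by (simp_all add: improve_def agree_except_def p_def)
      have inp2: "input_loaded s2" using improve_input_loaded s2 I by blast
      have dn: "?done s2 p'" if "p' < Suc p" for p'
      proof (cases "p' = p")
        case False
        then have p': "p' < p" using that by simp
        then have eq: "arr s2 7 p' = arr s1 7 p'" using s2 by (simp add: improve_def)
        have "?done s1 p'" using I p' by (simp add: p_def)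
        moreover have "arr s1 7 e \<le> arr s2 7 e" for e using s2 by (simp add: improve_def)
        ultimately show ?thesis unfolding eq using order_trans by blast
      qed (use s2 in simp)
      show "runs W ?c 10 s2 (\<lambda>s'. ?I s' \<and> n - reg s' 3 < n - reg s1 3)"
      proof (rule runs_step)
        show "csafe W ?c s2" using r3 p W_linear by simp
        have "sound (step ?c s2)" using s2 by (simp add: improve_def sound_def table_string_def)
        moreover have "1 \<le> arr s2 7 0" using s2 I by (simp add: improve_def)
        ultimately show "?I (step ?c s2) \<and> n - reg (step ?c s2) 3 < n - reg s1 3"
          using dn inp2 r3 p by (auto simp: input_loaded_def p_def)
      qed simp_all
    next
      show "4050 * (n + 1) ^ 3 + 10 \<le> 4100 * (n + 1) ^ 3" using one_le_power[of "n + 1" 3] by simp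
    qed
  next
    have "(n + 1) * (4 + 4100 * (n + 1) ^ 3) \<le> (n + 1) * (4900 * (n + 1) ^ 3)"
      using one_le_power[of "n + 1" 3] by (intro mult_le_mono) auto
    also have "N * (4900 * N ^ 3) = 4900 * N ^ 4" for N :: nat
      by (simp add: power3_eq_cube power4_eq_xxxx)
    finally show "(n - reg (step (Assign 3 (Const 0)) s) 3 + 1) * (1 + bcost ?b + 4100 * (n + 1) ^ 3)
        \<le> 4900 * (n + 1) ^ 4" by (simp add: algebra_simps)
  next
    fix s' assume I: "?I s'" and b: "\<not> bval ?b s'"
    have r: "reg s' 3 = n" using I b by (simp add: input_loaded_def)
    have "Suc (length w) \<le> arr s' 7 q" if "prefix_solution q w" for q w
      using that
    proof (induction rule: prefix_solution.induct)
      case prefix_solution_0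
      then show ?case using I by simp
    next
      case (prefix_solution_step p w q d x)
      have "p < reg s' 3" using prefix_solution_step r by simp
      then have "arr s' 7 p + d * card (new_letters p q) \<le> arr s' 7 q" using I prefix_solution_step by fastforce
      then show ?case using prefix_solution_step is_block_length[of p q d x] by simp
    qed
    then show "?Q s'" using I by blast
  qed simp_all
  show "ccost (Assign 3 (Const 0)) + 4900 * (n + 1) ^ 4 \<le> 5000 * (n + 1) ^ 4"
    using one_le_power[of "n + 1" 4] by simp
qed (use W_linear in simp_all)

lemma output_runs:
  assumes input_loaded: "input_loaded s" and V: "arr s 7 n = Suc w" and w: "w \<le> n"
  shows "runs W output_prog (100 * (n + 1)) s (\<lambda>s'. output_of s' = Some (table_string s n))"
  unfolding output_prog_def
proof (rule runs_Seq_step)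
  let ?c = "Assign 11 (Const 0) ;; Assign 14 (Times (Reg 0) (Plus (Reg 0) (Const 1))) ;;
     Assign 1 (Minus (Load 7 (Reg 0)) (Const 1)) ;; Assign 0 (Const 1)"
  let ?d = "Store 1 (Reg 11) (Load 8 (Plus (Reg 14) (Reg 11))) ;; Assign 11 (Plus (Reg 11) (Const 1))"
  let ?I = "\<lambda>s'. reg s' 0 = 1 \<and> reg s' 1 = w \<and> reg s' 11 \<le> w \<and> reg s' 14 = row_start n \<and>
    arr s' 8 = arr s 8 \<and> (\<forall>i < reg s' 11. arr s' 1 i = arr s 8 (row_start n + i))"
  have n: "reg s 0 = n" using input_loaded by (simp add: input_loaded_def)
  show "csafe W ?c s" using n W_linear row_start_W[of n 0] by (simp add: row_start_def)
  show "runs W (While (Less (Reg 11) (Reg 1)) ?d) (50 * (n + 1)) (step ?c s)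
    (\<lambda>s'. output_of s' = Some (table_string s n))"
  proof (rule runs_While[where t = 30 and \<mu> = "\<lambda>s'. w - reg s' 11" and I = ?I])
    show "?I (step ?c s)" using n V by (simp add: row_start_def)
  next
    fix s1 assume I: "?I s1" and b: "bval (Less (Reg 11) (Reg 1)) s1"
    show "runs W ?d 30 s1 (\<lambda>s'. ?I s' \<and> w - reg s' 11 < w - reg s1 11)"
    proof (rule runs_step)
      show "csafe W ?d s1" using I b w W_linear row_start_W[of n "reg s1 11"] by simp
      show "?I (step ?d s1) \<and> w - reg (step ?d s1) 11 < w - reg s1 11"
        using I b by (auto simp: less_Suc_eq)
    qed simp_all
  next
    fix s' assume I: "?I s'" and b: "\<not> bval (Less (Reg 11) (Reg 1)) s'"
    then have "reg s' 11 = w" by simp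
    then have "\<forall>i < w. arr s' 1 i = arr s 8 (row_start n + i)" using I by simp
    then show "output_of s' = Some (table_string s n)" using I V by (simp add: output_of_def table_string_def)
  qed (use w in simp_all)
qed simp_all

lemma final_runs:
  assumes input_loaded: "input_loaded s" and sound: "sound s" and m: "reg s 1 = m" and S: "set S \<subseteq> {..<m}"
    and opt: "\<And>w. prefix_solution n w \<Longrightarrow> Suc (length w) \<le> arr s 7 n"
  shows "runs W final_prog (500 * (n + 1)) s (\<lambda>s'. lsrs_plus_answer {..<m} S (output_of s'))"
  unfolding final_prog_def
proof (rule runs_Seq_step)
  let ?c = "Assign 3 (Const 0) ;; Assign 5 (Reg 0)"
  let ?b = "And (Equal (Reg 7) (Reg 1)) (And (Less (Const 0) (Reg 1)) (Less (Const 0) (Load 7 (Reg 0))))"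
  let ?Q = "\<lambda>s'. lsrs_plus_answer {..<m} S (output_of s')"
  show "csafe W ?c s" using W_linear by simp
  show "runs W (build_prog ;; If ?b output_prog (Assign 0 (Const 0))) (450 * (n + 1)) (step ?c s) ?Q"
  proof (rule runs_Seq)
    show "runs W build_prog (100 * (n + 1)) (step ?c s) (\<lambda>s'. agree_except {2, 6, 7, 8, 10} {6} (step ?c s) s' \<and>
      reg s' 6 = length (kept 0 n (arr s 5)) \<and> map (arr s' 6) [0..<reg s' 6] = kept_word 0 n (arr s 5) \<and>
      reg s' 7 = card (new_letters 0 n) \<and> (\<forall>e. reg s' 8 \<le> e \<longleftrightarrow> (\<forall>i \<in> set (kept 0 n (arr s 5)). i \<le> e)))"
      using input_loaded by (intro build_runs) (auto simp: input_loaded_def)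
    fix s1 assume "agree_except {2, 6, 7, 8, 10} {6} (step ?c s) s1 \<and>
      reg s1 6 = length (kept 0 n (arr s 5)) \<and> map (arr s1 6) [0..<reg s1 6] = kept_word 0 n (arr s 5) \<and>
      reg s1 7 = card (new_letters 0 n) \<and> (\<forall>e. reg s1 8 \<le> e \<longleftrightarrow> (\<forall>i \<in> set (kept 0 n (arr s 5)). i \<le> e))"
    then have s1: "reg s1 7 = card (new_letters 0 n)" "reg s1 1 = m" "arr s1 7 = arr s 7" "arr s1 8 = arr s 8" "input_loaded s1"
      using input_loaded m by (auto simp: agree_except_def input_loaded_def)
    \<comment> \<open>Inside a finite alphabet, equality of sets can be tested by counting.\<close>
    have new_letters: "new_letters 0 n = {..<m} \<longleftrightarrow> card (new_letters 0 n) = m"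
    proof
      assume "card (new_letters 0 n) = m"
      moreover have "new_letters 0 n \<subseteq> {..<m}" using new_letters_subset_set S by blast
      ultimately show "new_letters 0 n = {..<m}" by (intro card_subset_eq) auto
    qed simp
    show "runs W (If ?b output_prog (Assign 0 (Const 0))) (150 * (n + 1)) s1 ?Q"
    proof (rule runs_If)
      show "bsafe W ?b s1" using W_linear by simp
      show "runs W output_prog (100 * (n + 1)) s1 ?Q" if b: "bval ?b s1"
      proof -
        have V: "arr s 7 n \<noteq> 0" and Lm: "new_letters 0 n = {..<m}" "0 < m"
          using b s1 new_letters by (auto simp: input_loaded_def)
        have g: "prefix_solution n (table_string s n)" using sound V by (simp add: sound_def)
        have st: "table_string s1 n = table_string s n" using s1 by (simp add: table_string_def)
        obtain w where w: "arr s 7 n = Suc w" using V not0_implies_Suc by blast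
        have "w \<le> n" using prefix_solution_length[OF g] by (simp add: table_string_def w)
        show ?thesis
        proof (rule runs_mono[OF output_runs[where w = w] order_refl])
          fix s' assume "output_of s' = Some (table_string s1 n)"
          moreover have "length w' \<le> length (table_string s n)" if "lsrs_plus_feasible {..<m} S w'" for w'
            using opt[OF feasible_imp_prefix_solution(1)[OF that S]] by (simp add: table_string_def)
          ultimately show "?Q s'"
            using prefix_solution_imp_feasible[OF g Lm] by (simp add: lsrs_plus_answer_def st)
        qed (use s1 w \<open>w \<le> n\<close> in simp_all)
      qed
      show "runs W (Assign 0 (Const 0)) (100 * (n + 1)) s1 ?Q" if b: "\<not> bval ?b s1"
      proof (rule runs_step)
        have "\<not> lsrs_plus_feasible {..<m} S w" for w
        proof
          assume f: "lsrs_plus_feasible {..<m} S w"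
          have "card (new_letters 0 n) = m" using feasible_imp_prefix_solution(2)[OF f S] by simp
          moreover have "0 < m" by (rule feasible_nonempty_alphabet[OF f S])
          moreover have "0 < arr s 7 n" using opt[OF feasible_imp_prefix_solution(1)[OF f S]] by simp
          ultimately show False using b s1 by (simp add: input_loaded_def)
        qed
        then show "?Q (step (Assign 0 (Const 0)) s1)" by (simp add: output_of_def lsrs_plus_answer_def)
        show "csafe W (Assign 0 (Const 0)) s1" using W_linear by simp
      qed simp_all
    qed simp
  qed simp
qed simp_all

end

theorem theorem5:
  shows "\<exists>(prog :: com) (k :: nat) (T :: nat \<Rightarrow> nat).
     (\<lambda>n. real (T n)) \<in> O(\<lambda>n. real n ^ 4) \<and>
     (\<forall>(m :: nat) (S :: nat list).
        lsrs_plus_instance 3 {..<m} S \<longrightarrow>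
        (\<exists>t s. exec ((length S + m + 2) ^ k) prog (input_state m S) t s \<and>
               t \<le> T (length S) \<and>
               lsrs_plus_answer {..<m} S (output_of s)))"
proof (rule exI[of _ lsrs_prog], rule exI[of _ 4], rule exI[of _ "\<lambda>n. 6000 * (n + 1) ^ 4"],
    intro conjI allI impI)
  let ?T = "\<lambda>n :: nat. 6000 * (n + 1) ^ 4"
  \<comment> \<open>The constant is 6000 * 2^4, from \<open>n + 1 \<le> 2 * n\<close>.\<close>
  have "real (?T n) \<le> 96000 * (real n ^ 4)" if "n \<ge> 1" for n :: nat
  proof -
    have "(real n + 1) ^ 4 \<le> (2 * real n) ^ 4" using that by (intro power_mono) auto
    then show ?thesis by (simp add: power_mult_distrib add.commute)
  qed
  then show "(\<lambda>n. real (?T n)) \<in> O(\<lambda>n. real n ^ 4)"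
    by (intro bigoI[where c = 96000] eventually_sequentiallyI[of 1]) simp
next
  fix m :: nat and S :: "nat list"
  assume inst: "lsrs_plus_instance 3 {..<m} S"
  let ?W = "(length S + m + 2) ^ 4"
  have S: "set S \<subseteq> {..<m}" using inst by (simp add: lsrs_plus_instance_def)
  have "count_list S a \<le> 3" for a
    proof (cases "a \<in> set S")
    case True
    then show ?thesis using inst S by (auto simp: lsrs_plus_instance_def)
  qed (simp add: count_list_0_iff[THEN iffD2])
  \<comment> \<open>This fixes the exponent 4 of the word bound: two factors cover the quadratic
    table, the other two are at least 2 each and absorb the constant 4.\<close>
  moreover have "4 * (length S + 2)\<^sup>2 \<le> ?W"
  proof -
    have "2\<^sup>2 * (length S + 2)\<^sup>2 \<le> (length S + m + 2)\<^sup>2 * (length S + m + 2)\<^sup>2"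
      by (intro mult_le_mono power_mono) auto
    then show ?thesis by (simp flip: power_add)
  qed
  ultimately interpret machine S ?W by unfold_locales
  let ?s = "input_state m S"
  have le: "length S + m + 2 \<le> ?W" using power_increasing[of 1 4 "length S + m + 2"] by simp
  \<comment> \<open>The letters themselves are machine words and array addresses, so the word bound
    has to exceed the alphabet size.\<close>
  have "S ! i < m" if "i < length S" for i using S nth_mem[OF that] by auto
  then have "S ! i < ?W" if "i < length S" for i using le that by fastforce
  then have bnd: "bnd ?W ?s" using le by (auto simp: bnd_def input_state_def)
  have "runs ?W lsrs_prog (6000 * (length S + 1) ^ 4) ?s (\<lambda>s'. lsrs_plus_answer {..<m} S (output_of s'))"
    unfolding lsrs_prog_def
  proof (rule runs_Seq)
    show "runs ?W occ_prog (100 * (length S + 1)) ?s (\<lambda>s'. input_loaded s' \<and> agree_except {2, 10} {2, 3, 4} ?s s')"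
      by (rule occ_runs) (auto simp: input_state_def)
    fix s1 assume s1: "input_loaded s1 \<and> agree_except {2, 10} {2, 3, 4} ?s s1"
    let ?c = "Store 7 (Const 0) (Const 1)"
    show "runs ?W (?c ;; start_loop ;; final_prog) (5600 * (length S + 1) ^ 4) s1
      (\<lambda>s'. lsrs_plus_answer {..<m} S (output_of s'))"
    proof (rule runs_Seq_step)
      show "csafe ?W ?c s1" using W_linear by simp
      show "runs ?W (start_loop ;; final_prog) (5500 * (length S + 1) ^ 4) (step ?c s1)
        (\<lambda>s'. lsrs_plus_answer {..<m} S (output_of s'))"
      proof (rule runs_Seq[OF start_loop_runs])
        show "input_loaded (step ?c s1)" using s1 by (simp add: input_loaded_def)
        show "arr (step ?c s1) 7 = (\<lambda>_. 0)(0 := 1)"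
          using s1 by (auto simp: agree_except_def input_state_def)
        fix s2 assume "input_loaded s2 \<and> sound s2 \<and> reg s2 1 = reg (step ?c s1) 1 \<and>
          (\<forall>q w. prefix_solution q w \<longrightarrow> Suc (length w) \<le> arr s2 7 q)"
        moreover have "reg s1 1 = m" using s1 by (simp add: agree_except_def input_state_def)
        ultimately show "runs ?W final_prog (500 * (length S + 1)) s2
          (\<lambda>s'. lsrs_plus_answer {..<m} S (output_of s'))"
          by (intro final_runs[OF _ _ _ S]) auto
      next
        show "5000 * (length S + 1) ^ 4 + 500 * (length S + 1) \<le> 5500 * (length S + 1) ^ 4"
          using power_increasing[of 1 4 "length S + 1"] by simp
      qed
      show "ccost ?c + 5500 * (length S + 1) ^ 4 \<le> 5600 * (length S + 1) ^ 4"
      proof -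
        have "1 \<le> (length S + 1) ^ 4" "ccost ?c = 3" by simp_all
        then show ?thesis by linarith
      qed
    qed simp
  next
    show "100 * (length S + 1) + 5600 * (length S + 1) ^ 4 \<le> 6000 * (length S + 1) ^ 4"
      using power_increasing[of 1 4 "length S + 1"] by simp
  qed
  then obtain t s where ts: "exec ?W lsrs_prog ?s t s" "t \<le> 6000 * (length S + 1) ^ 4"
      "lsrs_plus_answer {..<m} S (output_of s)"
    using bnd unfolding runs_def by blast
  then show "\<exists>t s. exec ?W lsrs_prog ?s t s \<and> t \<le> 6000 * (length S + 1) ^ 4 \<and>
      lsrs_plus_answer {..<m} S (output_of s)" by blast
qed

end
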